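(* Let $t\in[1,2]$ and let $c_I,c_A$ be sufficiently small depending only on $\eta$. There exists a constant $c'>0$ depending only on $\eta$ such that for every test $\psi$ there exists $q\in[0,1]^N$ with $$\|q-p\|_t\ge c'\left(\sqrt{\frac{\|p_{\le I}\|_r}{n}}+\frac{\|p_{>I}\|_1^{\frac{2-t}{t}}}{n^{\frac{2t-2}{t}}}+\frac1n\right)\quad\text{and}\quad\mathbb P_p(\psi=1)+\mathbb P_q(\psi=0)\ge\eta.$$ In particular $\rho^*\gtrsim_\eta\sqrt{\|p_{\le I}\|_r/n}+\|p_{>I}\|_1^{(2-t)/t}/n^{(2t-2)/t}+1/n$.
   Context: Binomial model: $N\ge2$, $n\ge2$ even. For $q\in[0,1]^N$ one observes $X_1,\dots,X_n$ i.i.d. in $\{0,1\}^N$ with mutually independent coordinates $X_l(j)\sim\mathrm{Ber}(q_j)$; $\mathbb P_q$ is their joint law; a test is a measurable $\psi:(\{0,1\}^N)^n\to\{0,1\}$. $\|x\|_s=(\sum_j|x_j|^s)^{1/s}$. Known $p\in[0,1]^N$ with $p_1\ge\dots\ge p_N$ and $\max_jp_j\le1/2$; $\eta\in(0,1)$; $\rho^*=\inf\{\rho>0:\inf_\psi[\mathbb P_p(\psi=1)+\sup_{q\in[0,1]^N:\|p-q\|_t\ge\rho}\mathbb P_q(\psi=0)]\le\eta\}$. Notation: $r=\frac{2t}{4-t}$, $b=\frac{4-2t}{4-t}$; $x_{\le u}=(x_1,\dots,x_u,0,\dots,0)$, $x_{>u}=(0,\dots,0,x_{u+1},\dots,x_N)$.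 $I=\min\{J\in\{0,\dots,N\}:\sum_{i>J}p_i^2\le c_I/n^2\}$; $A=\max\{a\in\{1,\dots,I\}:p_a^{b/2}\ge c_A/(\sqrt n(\sum_{i\le I}p_i^r)^{1/4})\}$ with $\max\emptyset=-\infty$, $x_{\le-\infty}=0$, $x_{>-\infty}=x$; $c_I,c_A>0$ are small constants depending only on $\eta$. *)

theory Defs
  imports Complex_Main
begin

text \<open>Coordinates are indexed by j in {1..N}, samples by l in {1..n}.
  An observation X = (X_1,...,X_n) in ({0,1}^N)^n is encoded as a function
  x :: nat => nat => bool, x l j = X_l(j), which is False outside the index range.\<close>

definition samples :: "nat \<Rightarrow> nat \<Rightarrow> (nat \<Rightarrow> nat \<Rightarrow> bool) set" where
  "samples n N = {x. \<forall>l j. (l \<notin> {1..n} \<or> j \<notin> {1..N}) \<longrightarrow> \<not> x l j}"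

definition binom_weight :: "nat \<Rightarrow> nat \<Rightarrow> (nat \<Rightarrow> real) \<Rightarrow> (nat \<Rightarrow> nat \<Rightarrow> bool) \<Rightarrow> real" where
  "binom_weight n N q x = (\<Prod>l\<in>{1..n}. \<Prod>j\<in>{1..N}. if x l j then q j else 1 - q j)"

definition binom_prob :: "nat \<Rightarrow> nat \<Rightarrow> (nat \<Rightarrow> real) \<Rightarrow> ((nat \<Rightarrow> nat \<Rightarrow> bool) \<Rightarrow> bool) \<Rightarrow> real" where
  "binom_prob n N q E = (\<Sum>x\<in>samples n N. if E x then binom_weight n N q x else 0)"

definition lnorm :: "real \<Rightarrow> nat \<Rightarrow> (nat \<Rightarrow> real) \<Rightarrow> real" where
  "lnorm s N x = (\<Sum>j\<in>{1..N}. \<bar>x j\<bar> powr s) powr (1 / s)"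

definition trunc_le :: "nat \<Rightarrow> (nat \<Rightarrow> real) \<Rightarrow> nat \<Rightarrow> real" where
  "trunc_le u x = (\<lambda>j. if j \<le> u then x j else 0)"

definition trunc_gt :: "nat \<Rightarrow> (nat \<Rightarrow> real) \<Rightarrow> nat \<Rightarrow> real" where
  "trunc_gt u x = (\<lambda>j. if j > u then x j else 0)"

definition idx_I :: "real \<Rightarrow> nat \<Rightarrow> nat \<Rightarrow> (nat \<Rightarrow> real) \<Rightarrow> nat" where
  "idx_I cI n N p = (LEAST J. J \<le> N \<and> (\<Sum>i\<in>{J<..N}. (p i)^2) \<le> cI / (real n)^2)"

text \<open>Real power with the convention a^0 = 1 (also for a = 0).\<close>
definition rpow :: "real \<Rightarrow> real \<Rightarrow> real" where
  "rpow a e = (if e = 0 then 1 else a powr e)"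

end

theory Submission
  imports Defs "HOL-Analysis.Infinite_Products" "HOL-Library.FuncSet"
begin

text \<open>Each of the three terms is attained, up to a constant, by a product prior under which every
  \<open>q j\<close> takes at most two values, so that Le Cam's two-point argument applies.
  Moving one coordinate by order \<open>1 / n\<close> gives the last term.
  For large \<open>p j\<close> one takes \<open>q j = p j \<plusminus> \<gamma> j\<close> with \<open>\<gamma> j\<close> proportional to
  \<open>p j powr (2 / (4 - t))\<close>; the chi-square divergence is controlled by
  \<open>n\<^sup>2 * (\<Sum>j. \<gamma> j ^ 4 / (p j)\<^sup>2)\<close>.
  On a set \<open>T\<close> with \<open>(\<Sum>j\<in>T. (p j)\<^sup>2)\<close> at most of order \<open>1 / n\<^sup>2\<close>, one takes \<open>q j = \<gamma>\<close> with
  probability \<open>p j / \<gamma>\<close> and \<open>q j = 0\<close> otherwise, where \<open>\<gamma>\<close> is of order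
  \<open>1 / (n\<^sup>2 * (\<Sum>j\<in>T. p j))\<close>: the means agree, and columns with two or more ones are too rare
  to tell the two laws apart.
  If the symmetric perturbation is not allowed on coordinates carrying half of
  \<open>(\<Sum>j\<le>I. p j powr r)\<close>, the minimality of \<open>I\<close> shows that the sparse prior on the remaining
  coordinates already dominates the first term.\<close>

subsection \<open>Column weights and mixtures\<close>

text \<open>A column lists the \<open>n\<close> samples of one coordinate. Its value outside
  \<open>{1..n}\<close> is fixed to \<open>undefined\<close>, which keeps the set finite and lets
  sums of products factor. With \<open>N\<close> in place of \<open>n\<close> the same set indexes
  the choices \<open>s\<close> of a prior.\<close>

definition columns :: "nat \<Rightarrow> (nat \<Rightarrow> bool) set" where
  "columns n = PiE {1..n} (\<lambda>_. UNIV)"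

definition col_weight :: "nat \<Rightarrow> real \<Rightarrow> (nat \<Rightarrow> bool) \<Rightarrow> real" where
  "col_weight n \<theta> y = (\<Prod>l\<in>{1..n}. if y l then \<theta> else 1 - \<theta>)"

lemma finite_columns [simp]: "finite (columns n)"
  unfolding columns_def by (intro finite_PiE) auto

lemma sum_prod_columns:
  fixes f :: "nat \<Rightarrow> bool \<Rightarrow> real"
  shows "(\<Sum>y\<in>columns n. \<Prod>l\<in>{1..n}. f l (y l)) = (\<Prod>l\<in>{1..n}. f l True + f l False)"
proof -
  have "(\<Prod>l\<in>{1..n}. f l True + f l False) = (\<Prod>l\<in>{1..n}. \<Sum>b\<in>UNIV. f l b)"
    by (simp add: UNIV_bool add.commute)
  then show ?thesis
    unfolding columns_def by (simp add: prod_sum_PiE)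
qed

lemma col_weight_nonneg:
  assumes "0 \<le> \<theta>" "\<theta> \<le> 1"
  shows "0 \<le> col_weight n \<theta> y"
  unfolding col_weight_def using assms by (intro prod_nonneg) auto

lemma sum_col_weight: "(\<Sum>y\<in>columns n. col_weight n \<theta> y) = 1"
  unfolding col_weight_def
  using sum_prod_columns[where n = n and f = "\<lambda>l b. if b then \<theta> else 1 - \<theta>"] by simp

text \<open>Transposing the data groups them by coordinate, the index along which the null law and
  the priors factor. The defaults of the two encodings differ, \<open>False\<close> for arrays and
  \<open>undefined\<close> for columns, hence the explicit bijection.\<close>

lemma binom_prob_columns:
  "binom_prob n N q E =
    (\<Sum>z\<in>PiE {1..N} (\<lambda>_. columns n).
       if E (\<lambda>l j. l \<in> {1..n} \<and> j \<in> {1..N} \<and> z j l)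
       then \<Prod>j\<in>{1..N}. col_weight n (q j) (z j) else 0)"
  unfolding binom_prob_def
proof (rule sum.reindex_bij_witness
    [where i = "\<lambda>z l j. l \<in> {1..n} \<and> j \<in> {1..N} \<and> z j l"
       and j = "\<lambda>x. restrict (\<lambda>j. restrict (\<lambda>l. x l j) {1..n}) {1..N}"])
  fix x assume x: "x \<in> samples n N"
  show inv: "(\<lambda>l j. l \<in> {1..n} \<and> j \<in> {1..N} \<and>
      restrict (\<lambda>j. restrict (\<lambda>l. x l j) {1..n}) {1..N} j l) = x"
    using x by (fastforce simp: samples_def fun_eq_iff)
  show "restrict (\<lambda>j. restrict (\<lambda>l. x l j) {1..n}) {1..N} \<in> PiE {1..N} (\<lambda>_. columns n)"
    by (auto simp: columns_def)
  have "binom_weight n N q x =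
      (\<Prod>j\<in>{1..N}. col_weight n (q j) (restrict (\<lambda>j. restrict (\<lambda>l. x l j) {1..n}) {1..N} j))"
    unfolding binom_weight_def col_weight_def
    by (rule trans[OF prod.swap]) (intro prod.cong refl, auto)
  then show "(if E (\<lambda>l j. l \<in> {1..n} \<and> j \<in> {1..N} \<and>
       restrict (\<lambda>j. restrict (\<lambda>l. x l j) {1..n}) {1..N} j l)
       then \<Prod>j\<in>{1..N}. col_weight n (q j) (restrict (\<lambda>j. restrict (\<lambda>l. x l j) {1..n}) {1..N} j)
       else 0) = (if E x then binom_weight n N q x else 0)"
    unfolding inv by simp
next
  fix z assume z: "z \<in> PiE {1..N} (\<lambda>_. columns n)"
  show "(\<lambda>l j. l \<in> {1..n} \<and> j \<in> {1..N} \<and> z j l) \<in> samples n N"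
    by (auto simp: samples_def)
  show "restrict (\<lambda>j. restrict (\<lambda>l. l \<in> {1..n} \<and> j \<in> {1..N} \<and> z j l) {1..n}) {1..N} = z"
  proof
    fix j
    show "restrict (\<lambda>j. restrict (\<lambda>l. l \<in> {1..n} \<and> j \<in> {1..N} \<and> z j l) {1..n}) {1..N} j = z j"
    proof (cases "j \<in> {1..N}")
      case True
      then have "z j \<in> PiE {1..n} (\<lambda>_. UNIV)"
        using z by (auto simp: columns_def)
      then have "z j l = undefined" if "l \<notin> {1..n}" for l
        using that by (rule PiE_arb)
      then show ?thesis
        using True by (auto simp: restrict_def fun_eq_iff)
    next
      case False
      then show ?thesis
        using False PiE_arb[OF z False] by (simp only: restrict_def if_False)
    qed
  qed
qed

text \<open>Le Cam's argument: \<open>W\<close> is a prior on the alternatives \<open>Q s\<close>, concentrated on the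
  good ones, and the sum of minima is one minus the total variation distance between the null
  and the mixture.\<close>

lemma mixture_lower_bound:
  fixes W :: "'s \<Rightarrow> real" and P :: "'z \<Rightarrow> real" and Q :: "'s \<Rightarrow> 'z \<Rightarrow> real"
  assumes fin: "finite Z" "finite S"
    and W: "\<And>s. s \<in> S \<Longrightarrow> 0 \<le> W s" "(\<Sum>s\<in>S. W s) = 1"
    and P: "\<And>z. z \<in> Z \<Longrightarrow> 0 \<le> P z" "(\<Sum>z\<in>Z. P z) = 1"
    and Q: "\<And>s z. s \<in> S \<Longrightarrow> z \<in> Z \<Longrightarrow> 0 \<le> Q s z" "\<And>s. s \<in> S \<Longrightarrow> (\<Sum>z\<in>Z. Q s z) = 1"
    and affinity: "1 - \<delta> \<le> (\<Sum>z\<in>Z. min (\<Sum>s\<in>S. W s * Q s z) (P z))"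
    and bad: "(\<Sum>s\<in>{s\<in>S. \<not> good s}. W s) \<le> \<beta>"
    and small: "\<delta> + 2 * \<beta> < 1 - \<eta>" and eta: "0 \<le> \<eta>"
  shows "\<exists>s\<in>S. good s \<and>
    \<eta> \<le> (\<Sum>z\<in>Z. if E z then P z else 0) + (\<Sum>z\<in>Z. if \<not> E z then Q s z else 0)"
proof (rule ccontr)
  define err where
    "err s = (\<Sum>z\<in>Z. if E z then P z else 0) + (\<Sum>z\<in>Z. if \<not> E z then Q s z else 0)" for s
  assume "\<not> ?thesis"
  then have low: "err s \<le> \<eta>" if "s \<in> S" "good s" for s
    using that unfolding err_def by force
  \<comment> \<open>This crude bound is all that is known for alternatives that are not good; it
    causes the factor 2 in front of \<open>\<beta>\<close>.\<close>
  have high: "err s \<le> 2" if "s \<in> S" for s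
  proof -
    have "(\<Sum>z\<in>Z. if E z then P z else 0) \<le> (\<Sum>z\<in>Z. P z)"
      using P(1) by (intro sum_mono) auto
    moreover have "(\<Sum>z\<in>Z. if \<not> E z then Q s z else 0) \<le> (\<Sum>z\<in>Z. Q s z)"
      using Q(1)[OF that] by (intro sum_mono) auto
    ultimately show ?thesis
      unfolding err_def using P(2) Q(2)[OF that] by linarith
  qed
  have "(\<Sum>s\<in>S. W s * err s) \<le> (\<Sum>s\<in>S. W s * \<eta> + (if \<not> good s then 2 * W s else 0))"
  proof (intro sum_mono)
    fix s assume s: "s \<in> S"
    show "W s * err s \<le> W s * \<eta> + (if \<not> good s then 2 * W s else 0)"
    proof (cases "good s")
      case True
      then show ?thesis
        using mult_left_mono[OF low[OF s True] W(1)[OF s]] by simp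
    next
      case False
      have "W s * err s \<le> W s * (\<eta> + 2)"
        using high[OF s] eta by (intro mult_left_mono W(1)[OF s]) linarith
      then show ?thesis
        using False by (simp add: algebra_simps)
    qed
  qed
  also have "\<dots> = \<eta> + 2 * (\<Sum>s\<in>{s\<in>S. \<not> good s}. W s)"
    using W(2) by (simp add: sum.distrib fin flip: sum_distrib_right sum.inter_filter sum_distrib_left)
  finally have upper: "(\<Sum>s\<in>S. W s * err s) \<le> \<eta> + 2 * \<beta>"
    using bad by linarith
  define PE where "PE = (\<Sum>z\<in>Z. if E z then P z else 0)"
  have "(\<Sum>s\<in>S. W s * err s) = (\<Sum>s\<in>S. W s) * PE
       + (\<Sum>s\<in>S. \<Sum>z\<in>Z. W s * (if \<not> E z then Q s z else 0))"
    unfolding err_def PE_def[symmetric]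
    by (simp only: distrib_left sum.distrib sum_distrib_left[of "W _"] sum_distrib_right[symmetric])
  also have "\<dots> = (\<Sum>z\<in>Z. if E z then P z else 0)
       + (\<Sum>z\<in>Z. \<Sum>s\<in>S. W s * (if \<not> E z then Q s z else 0))"
    unfolding PE_def using W(2) by (subst sum.swap) simp
  also have "\<dots> = (\<Sum>z\<in>Z. if E z then P z else \<Sum>s\<in>S. W s * Q s z)"
    by (subst sum.distrib[symmetric]) (auto intro: sum.cong)
  \<comment> \<open>At each \<open>z\<close> the test pays either the null weight or the mixture
    weight, hence at least their minimum.\<close>
  also have "\<dots> \<ge> (\<Sum>z\<in>Z. min (\<Sum>s\<in>S. W s * Q s z) (P z))"
    by (intro sum_mono) auto
  finally show False
    using upper affinity small by linarith
qed

section \<open>Two-point product priors\<close>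

text \<open>The test is fixed first and \<open>q\<close> may depend on it. Passing to a smaller
  \<open>d\<close> is free, so each rate can be treated alone and the largest one kept.\<close>

definition undetectable ::
  "real \<Rightarrow> real \<Rightarrow> nat \<Rightarrow> nat \<Rightarrow> (nat \<Rightarrow> real) \<Rightarrow> ((nat \<Rightarrow> nat \<Rightarrow> bool) \<Rightarrow> bool) \<Rightarrow> real \<Rightarrow> bool"
where
  "undetectable \<eta> t n N p \<psi> d \<longleftrightarrow>
    (\<exists>q. (\<forall>j\<in>{1..N}. 0 \<le> q j \<and> q j \<le> 1) \<and> d \<le> lnorm t N (\<lambda>j. q j - p j) \<and>
         \<eta> \<le> binom_prob n N p (\<lambda>x. \<psi> x) + binom_prob n N q (\<lambda>x. \<not> \<psi> x))"

lemma undetectable_mono: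
  "undetectable \<eta> t n N p \<psi> d \<Longrightarrow> d' \<le> d \<Longrightarrow> undetectable \<eta> t n N p \<psi> d'"
  unfolding undetectable_def by (meson order_trans)

definition prior_weight :: "nat \<Rightarrow> (nat \<Rightarrow> real) \<Rightarrow> (nat \<Rightarrow> bool) \<Rightarrow> real" where
  "prior_weight N w s = (\<Prod>j\<in>{1..N}. if s j then w j else 1 - w j)"

definition col_mixture :: "nat \<Rightarrow> real \<Rightarrow> real \<Rightarrow> real \<Rightarrow> (nat \<Rightarrow> bool) \<Rightarrow> real" where
  "col_mixture n w a b y = w * col_weight n a y + (1 - w) * col_weight n b y"

lemma col_mixture_nonneg:
  assumes "w \<in> {0..1}" "a \<in> {0..1}" "b \<in> {0..1}"
  shows "0 \<le> col_mixture n w a b y"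
  unfolding col_mixture_def using assms by (intro add_nonneg_nonneg mult_nonneg_nonneg col_weight_nonneg) auto

lemma sum_col_mixture: "(\<Sum>y\<in>columns n. col_mixture n w a b y) = 1"
  unfolding col_mixture_def
  by (simp add: sum.distrib sum_col_weight flip: sum_distrib_left)

text \<open>Averaging a product over independent choices gives a product of averaged columns. Le
  Cam's argument thus needs only the affinity of two product laws and the prior mass of the choices
  that lie too close to \<open>p\<close>.\<close>

lemma two_point_prior:
  assumes p: "\<And>j. j \<in> {1..N} \<Longrightarrow> p j \<in> {0..1}"
    and a: "\<And>j. j \<in> {1..N} \<Longrightarrow> a j \<in> {0..1}"
    and b: "\<And>j. j \<in> {1..N} \<Longrightarrow> b j \<in> {0..1}"
    and w: "\<And>j. j \<in> {1..N} \<Longrightarrow> w j \<in> {0..1}"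
    and affinity: "1 - \<delta> \<le> (\<Sum>z\<in>PiE {1..N} (\<lambda>_. columns n).
        min (\<Prod>j\<in>{1..N}. col_mixture n (w j) (a j) (b j) (z j))
            (\<Prod>j\<in>{1..N}. col_weight n (p j) (z j)))"
    and bad: "(\<Sum>s\<in>{s\<in>columns N. \<not> d \<le> lnorm t N (\<lambda>j. (if s j then a j else b j) - p j)}.
        prior_weight N w s) \<le> \<beta>"
    and small: "\<delta> + 2 * \<beta> < 1 - \<eta>" and eta: "0 \<le> \<eta>"
  shows "undetectable \<eta> t n N p \<psi> d"
proof -
  let ?Z = "PiE {1..N} (\<lambda>_. columns n)"
  define Q where "Q s z = (\<Prod>j\<in>{1..N}. col_weight n (if s j then a j else b j) (z j))" for s z
  have sum1: "(\<Sum>z\<in>?Z. \<Prod>j\<in>{1..N}. col_weight n (f j) (z j)) = 1" for f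
    by (subst prod_sum_PiE[symmetric]) (auto simp: sum_col_weight)
  have mix: "(\<Sum>s\<in>columns N. prior_weight N w s * Q s z) =
      (\<Prod>j\<in>{1..N}. col_mixture n (w j) (a j) (b j) (z j))" for z
  proof -
    have "(\<Sum>s\<in>columns N. prior_weight N w s * Q s z) =
        (\<Sum>s\<in>columns N. \<Prod>j\<in>{1..N}. if s j then w j * col_weight n (a j) (z j)
            else (1 - w j) * col_weight n (b j) (z j))"
      unfolding prior_weight_def Q_def prod.distrib[symmetric]
      by (intro sum.cong prod.cong) auto
    also have "\<dots> = (\<Prod>j\<in>{1..N}. col_mixture n (w j) (a j) (b j) (z j))"
      using sum_prod_columns[where n = N and f = "\<lambda>j e. if e then w j * col_weight n (a j) (z j)
            else (1 - w j) * col_weight n (b j) (z j)"]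
      by (simp add: col_mixture_def)
    finally show ?thesis .
  qed
  have W1: "(\<Sum>s\<in>columns N. prior_weight N w s) = 1"
    unfolding prior_weight_def
    using sum_prod_columns[where n = N and f = "\<lambda>j e. if e then w j else 1 - w j"] by simp
  have "\<exists>s\<in>columns N. d \<le> lnorm t N (\<lambda>j. (if s j then a j else b j) - p j) \<and>
    \<eta> \<le> (\<Sum>z\<in>?Z. if \<psi> (\<lambda>l j. l \<in> {1..n} \<and> j \<in> {1..N} \<and> z j l)
          then \<Prod>j\<in>{1..N}. col_weight n (p j) (z j) else 0)
       + (\<Sum>z\<in>?Z. if \<not> \<psi> (\<lambda>l j. l \<in> {1..n} \<and> j \<in> {1..N} \<and> z j l) then Q s z else 0)"
  proof (rule mixture_lower_bound[where W = "prior_weight N w" and \<delta> = \<delta> and \<beta> = \<beta>])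
    show "finite ?Z"
      by (intro finite_PiE) auto
    show "0 \<le> prior_weight N w s" for s
      unfolding prior_weight_def using w by (intro prod_nonneg) auto
    show "0 \<le> (\<Prod>j\<in>{1..N}. col_weight n (p j) (z j))" for z
      using p by (intro prod_nonneg ballI col_weight_nonneg) auto
    show "0 \<le> Q s z" for s z
      unfolding Q_def using a b by (intro prod_nonneg ballI col_weight_nonneg) auto
    show "(\<Sum>z\<in>?Z. Q s z) = 1" for s
      unfolding Q_def by (rule sum1)
    show "1 - \<delta> \<le> (\<Sum>z\<in>?Z. min (\<Sum>s\<in>columns N. prior_weight N w s * Q s z)
        (\<Prod>j\<in>{1..N}. col_weight n (p j) (z j)))"
      unfolding mix by (rule affinity)
  qed (use W1 sum1 bad small eta in auto)
  then obtain s where "d \<le> lnorm t N (\<lambda>j. (if s j then a j else b j) - p j)"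
    "\<eta> \<le> binom_prob n N p \<psi> + binom_prob n N (\<lambda>j. if s j then a j else b j) (\<lambda>x. \<not> \<psi> x)"
    unfolding binom_prob_columns Q_def by blast
  then show ?thesis
    unfolding undetectable_def using a b
    by (intro exI[of _ "\<lambda>j. if s j then a j else b j"]) auto
qed

section \<open>Lower bounds for the affinity\<close>

text \<open>The minimum of two products of nonnegative numbers dominates the product of the minima,
  which factors over columns; the Weierstrass inequality then adds up the losses. This suffices when
  the total variation distances of the columns have a small sum.\<close>

lemma affinity_by_columns:
  fixes N n :: nat
  assumes p: "\<And>j. j \<in> {1..N} \<Longrightarrow> p j \<in> {0..1}"
    and a: "\<And>j. j \<in> {1..N} \<Longrightarrow> a j \<in> {0..1}"
    and b: "\<And>j. j \<in> {1..N} \<Longrightarrow> b j \<in> {0..1}"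
    and w: "\<And>j. j \<in> {1..N} \<Longrightarrow> w j \<in> {0..1}"
    and e: "\<And>j. j \<in> {1..N} \<Longrightarrow> e j \<in> {0..1}"
    and col: "\<And>j. j \<in> {1..N} \<Longrightarrow> 1 - e j \<le>
      (\<Sum>y\<in>columns n. min (col_mixture n (w j) (a j) (b j) y) (col_weight n (p j) y))"
  shows "1 - (\<Sum>j\<in>{1..N}. e j) \<le> (\<Sum>z\<in>PiE {1..N} (\<lambda>_. columns n).
        min (\<Prod>j\<in>{1..N}. col_mixture n (w j) (a j) (b j) (z j))
            (\<Prod>j\<in>{1..N}. col_weight n (p j) (z j)))"
proof -
  let ?m = "\<lambda>j y. min (col_mixture n (w j) (a j) (b j) y) (col_weight n (p j) y)"
  have nn: "0 \<le> ?m j y" if "j \<in> {1..N}" for j y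
    using col_mixture_nonneg[OF w a b, of j j j] col_weight_nonneg[of "p j"] p[OF that] that by auto
  have "1 - (\<Sum>j\<in>{1..N}. e j) \<le> (\<Prod>j\<in>{1..N}. 1 - e j)"
    by (rule Weierstrass_prod_ineq) (rule e)
  also have "\<dots> \<le> (\<Prod>j\<in>{1..N}. \<Sum>y\<in>columns n. ?m j y)"
    using e col by (intro prod_mono) force
  also have "\<dots> = (\<Sum>z\<in>PiE {1..N} (\<lambda>_. columns n). \<Prod>j\<in>{1..N}. ?m j (z j))"
    by (rule prod_sum_PiE) auto
  also have "\<dots> \<le> (\<Sum>z\<in>PiE {1..N} (\<lambda>_. columns n).
        min (\<Prod>j\<in>{1..N}. col_mixture n (w j) (a j) (b j) (z j))
            (\<Prod>j\<in>{1..N}. col_weight n (p j) (z j)))"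
    using nn by (intro sum_mono min.boundedI prod_mono) auto
  finally show ?thesis .
qed

text \<open>For the symmetric prior, adding total variation losses over columns is too costly.
  Second moments of the likelihood ratio multiply instead, and their excess over 1 is of the order
  of the squared losses. A weighted inequality between arithmetic and geometric means, with weight
  \<open>\<tau>\<close>, takes the place of Cauchy-Schwarz. Assumption \<open>ac\<close> is absolute
  continuity: division by zero yields 0 and would hide singular mass.\<close>

lemma affinity_chi_square:
  fixes N n :: nat
  assumes p: "\<And>j. j \<in> {1..N} \<Longrightarrow> p j \<in> {0..1}"
    and tau: "0 < \<tau>"
    and ac: "\<And>j y. j \<in> {1..N} \<Longrightarrow> col_weight n (p j) y = 0 \<Longrightarrow> col_mixture n (w j) (a j) (b j) y = 0"
    and a: "\<And>j. j \<in> {1..N} \<Longrightarrow> a j \<in> {0..1}"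
    and b: "\<And>j. j \<in> {1..N} \<Longrightarrow> b j \<in> {0..1}"
    and w: "\<And>j. j \<in> {1..N} \<Longrightarrow> w j \<in> {0..1}"
    and chi: "(\<Prod>j\<in>{1..N}. \<Sum>y\<in>columns n.
        (col_mixture n (w j) (a j) (b j) y)\<^sup>2 / col_weight n (p j) y) \<le> 1 + \<kappa>"
  shows "1 - (\<tau> / 2 + \<kappa> / (2 * \<tau>)) \<le> (\<Sum>z\<in>PiE {1..N} (\<lambda>_. columns n).
        min (\<Prod>j\<in>{1..N}. col_mixture n (w j) (a j) (b j) (z j))
            (\<Prod>j\<in>{1..N}. col_weight n (p j) (z j)))"
proof -
  let ?Z = "PiE {1..N} (\<lambda>_. columns n)"
  define M where "M z = (\<Prod>j\<in>{1..N}. col_mixture n (w j) (a j) (b j) (z j))" for z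
  define P where "P z = (\<Prod>j\<in>{1..N}. col_weight n (p j) (z j))" for z
  have sums: "(\<Sum>z\<in>?Z. M z) = 1" "(\<Sum>z\<in>?Z. P z) = 1"
    unfolding M_def P_def
    by (subst prod_sum_PiE[symmetric], auto simp: sum_col_weight sum_col_mixture)+
  have "(\<Sum>z\<in>?Z. (M z)\<^sup>2 / P z) = (\<Prod>j\<in>{1..N}. \<Sum>y\<in>columns n.
        (col_mixture n (w j) (a j) (b j) y)\<^sup>2 / col_weight n (p j) y)"
    unfolding M_def P_def
    by (subst prod_sum_PiE) (auto simp: prod_dividef prod_power_distrib)
  then have chi': "(\<Sum>z\<in>?Z. (M z)\<^sup>2 / P z) \<le> 1 + \<kappa>"
    using chi by simp
  \<comment> \<open>The positive part of \<open>P z - M z\<close> is at most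
    \<open>\<tau> / 2 * P z\<close> plus \<open>(M z - P z)^2 / (2 * \<tau> * P z)\<close>; summed
    over \<open>z\<close>, the latter becomes the chi-square divergence over
    \<open>2 * \<tau>\<close>.\<close>
  have pointwise: "P z - \<tau> / 2 * P z - ((M z)\<^sup>2 / P z - 2 * M z + P z) / (2 * \<tau>) \<le> min (M z) (P z)" for z
  proof (cases "P z = 0")
    case True
    then obtain j where j: "j \<in> {1..N}" "col_weight n (p j) (z j) = 0"
      unfolding P_def by (auto simp: prod_zero_iff)
    then have "M z = 0"
      unfolding M_def using ac[OF j] by (intro prod_zero) (auto intro: bexI[of _ j])
    then show ?thesis
      using True by simp
  next
    case False
    have "0 \<le> P z"
      unfolding P_def using p by (intro prod_nonneg ballI col_weight_nonneg) auto
    then have pos: "0 < P z"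
      using False by simp
    \<comment> \<open>The first square settles the case where the minimum is \<open>M z\<close>, the
      second the case where it is \<open>P z\<close>.\<close>
    have "0 \<le> (M z - P z + \<tau> * P z)\<^sup>2" "0 \<le> \<tau>\<^sup>2 * (P z)\<^sup>2 + (M z - P z)\<^sup>2"
      by auto
    then have "2 * \<tau> * P z * (P z - min (M z) (P z)) \<le> \<tau>\<^sup>2 * (P z)\<^sup>2 + (M z - P z)\<^sup>2"
      by (auto simp: min_def power2_eq_square algebra_simps)
    then have "P z - min (M z) (P z) \<le> (\<tau>\<^sup>2 * (P z)\<^sup>2 + (M z - P z)\<^sup>2) / (2 * \<tau> * P z)"
      using pos tau by (simp add: field_simps)
    also have "\<dots> = \<tau> / 2 * P z + ((M z)\<^sup>2 / P z - 2 * M z + P z) / (2 * \<tau>)"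
      using pos tau by (simp add: field_simps power2_eq_square)
    finally show ?thesis
      by linarith
  qed
  have "1 - (\<tau> / 2 + \<kappa> / (2 * \<tau>)) \<le> 1 - \<tau> / 2 - ((\<Sum>z\<in>?Z. (M z)\<^sup>2 / P z) - 2 + 1) / (2 * \<tau>)"
    using divide_right_mono[of "(\<Sum>z\<in>?Z. (M z)\<^sup>2 / P z) - 2 + 1" \<kappa> "2 * \<tau>"] chi' tau by simp
  also have "\<dots> = (\<Sum>z\<in>?Z. P z - \<tau> / 2 * P z - ((M z)\<^sup>2 / P z - 2 * M z + P z) / (2 * \<tau>))"
    unfolding sum_subtractf sum.distrib sum_distrib_left[symmetric] sum_divide_distrib[symmetric] sums
    by simp
  also have "\<dots> \<le> (\<Sum>z\<in>?Z. min (M z) (P z))"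
    by (intro sum_mono pointwise)
  finally show ?thesis
    unfolding M_def P_def .
qed

subsection \<open>Single and symmetric perturbations\<close>

text \<open>The prior is degenerate, with \<open>w = 1\<close> and \<open>a = b\<close>: only
  coordinate 1 moves, up by \<open>g / n\<close>, at a total variation cost of at most
  \<open>g / n\<close> per sample. All choices \<open>s\<close> give the same distance, hence
  \<open>\<beta> = 0\<close>.\<close>

lemma undetectable_single_shift:
  assumes p: "\<And>j. j \<in> {1..N} \<Longrightarrow> p j \<in> {0..1/2}" and N: "1 \<le> N" and n: "2 \<le> n"
    and t: "0 < t" and g: "0 \<le> g" "g \<le> 1" "g < 1 - \<eta>" and eta: "0 \<le> \<eta>"
  shows "undetectable \<eta> t n N p \<psi> (g / n)"
proof (rule two_point_prior[where \<delta> = g and \<beta> = 0 and w = "\<lambda>_. 1"])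
  define a where "a j = (if j = 1 then p j + g / n else p j)" for j
  have gn: "0 \<le> g / n" "g / n \<le> 1 / 2"
    using g n frac_le[of 1 g 2 "real n"] by auto
  show a: "a j \<in> {0..1}" "a j \<in> {0..1}" if "j \<in> {1..N}" for j
    using p[OF that] add_mono[OF _ gn(2), of "p j" "1/2"] gn(1) by (auto simp: a_def)
  show p': "p j \<in> {0..1}" if "j \<in> {1..N}" for j
    using p[OF that] by auto
  have "1 - (\<Sum>j\<in>{1..N}. if j = 1 then g else 0) \<le> (\<Sum>z\<in>PiE {1..N} (\<lambda>_. columns n).
        min (\<Prod>j\<in>{1..N}. col_mixture n 1 (a j) (a j) (z j))
            (\<Prod>j\<in>{1..N}. col_weight n (p j) (z j)))"
  proof (rule affinity_by_columns)
    fix j assume j: "j \<in> {1..N}"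
    show "1 - (if j = 1 then g else 0) \<le>
      (\<Sum>y\<in>columns n. min (col_mixture n 1 (a j) (a j) y) (col_weight n (p j) y))"
    proof (cases "j = 1")
      case True
      \<comment> \<open>In one sample the minima of the two Bernoulli laws add up to
        \<open>1 - g / n\<close>; Bernoulli's inequality bounds the power \<open>n\<close> of this
        from below.\<close>
      have "1 - g = 1 + real n * (- (g / n))"
        using n by simp
      also have "\<dots> \<le> (1 + (- (g / n))) ^ n"
        using gn by (intro Bernoulli_inequality) linarith
      also have "\<dots> = (\<Prod>l\<in>{1..n}. min (a j) (p j) + min (1 - a j) (1 - p j))"
        using True gn by (simp add: a_def)
      also have "\<dots> = (\<Sum>y\<in>columns n. \<Prod>l\<in>{1..n}.
          if y l then min (a j) (p j) else min (1 - a j) (1 - p j))"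
        using sum_prod_columns[where n = n and f = "\<lambda>l b. if b then min (a j) (p j) else min (1 - a j) (1 - p j)"]
        by simp
      also have "\<dots> \<le> (\<Sum>y\<in>columns n. min (col_mixture n 1 (a j) (a j) y) (col_weight n (p j) y))"
        unfolding col_mixture_def col_weight_def using a[OF j] p'[OF j]
        by (intro sum_mono) (auto intro!: prod_mono)
      finally show ?thesis
        using True by simp
    qed (simp add: a_def col_mixture_def sum_col_weight)
  qed (use a p' g in auto)
  then show "1 - g \<le> (\<Sum>z\<in>PiE {1..N} (\<lambda>_. columns n).
        min (\<Prod>j\<in>{1..N}. col_mixture n 1 (a j) (a j) (z j))
            (\<Prod>j\<in>{1..N}. col_weight n (p j) (z j)))"
    using N by simp
  have "(\<Sum>j\<in>{1..N}. \<bar>a j - p j\<bar> powr t) = (\<Sum>j\<in>{1..N}. if j = 1 then (g / n) powr t else 0)"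
    using gn by (intro sum.cong) (auto simp: a_def)
  then have "lnorm t N (\<lambda>j. a j - p j) = g / n"
    using N t g by (simp add: lnorm_def powr_powr)
  then show "(\<Sum>s\<in>{s\<in>columns N. \<not> g / n \<le> lnorm t N (\<lambda>j. (if s j then a j else a j) - p j)}.
        prior_weight N (\<lambda>_. 1) s) \<le> 0"
    by simp
qed (use g eta in auto)

text \<open>For one sample, the product of the likelihood ratios of \<open>a\<close> and
  \<open>b\<close> against \<open>p\<close> has mean
  \<open>1 + (a - p) * (b - p) / (p * (1 - p))\<close>. Expanding the square, shifts of equal sign
  give the plus term and shifts of opposite sign the minus term.\<close>

lemma chi_square_symmetric_column:
  assumes p: "0 < p" "p < 1"
  shows "(\<Sum>y\<in>columns n. (col_mixture n (1/2) (p + \<gamma>) (p - \<gamma>) y)\<^sup>2 / col_weight n p y) =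
    ((1 + \<gamma>\<^sup>2 / (p * (1 - p))) ^ n + (1 - \<gamma>\<^sup>2 / (p * (1 - p))) ^ n) / 2"
proof -
  have cross: "(\<Sum>y\<in>columns n. col_weight n a y * col_weight n b y / col_weight n p y) =
      (a * b / p + (1 - a) * (1 - b) / (1 - p)) ^ n" for a b
  proof -
    have "(\<Sum>y\<in>columns n. col_weight n a y * col_weight n b y / col_weight n p y) =
        (\<Sum>y\<in>columns n. \<Prod>l\<in>{1..n}. if y l then a * b / p else (1 - a) * (1 - b) / (1 - p))"
      unfolding col_weight_def prod.distrib[symmetric] prod_dividef[symmetric]
      by (intro sum.cong prod.cong) auto
    then show ?thesis
      using sum_prod_columns[where n = n and f = "\<lambda>l e. if e then a * b / p else (1 - a) * (1 - b) / (1 - p)"]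
      by simp
  qed
  have "(\<Sum>y\<in>columns n. (col_mixture n (1/2) (p + \<gamma>) (p - \<gamma>) y)\<^sup>2 / col_weight n p y) =
    (\<Sum>y\<in>columns n.
       (col_weight n (p + \<gamma>) y * col_weight n (p + \<gamma>) y / col_weight n p y
      + 2 * (col_weight n (p + \<gamma>) y * col_weight n (p - \<gamma>) y / col_weight n p y)
      + col_weight n (p - \<gamma>) y * col_weight n (p - \<gamma>) y / col_weight n p y) / 4)"
    unfolding col_mixture_def
    by (intro sum.cong) (simp_all add: power2_eq_square add_divide_distrib algebra_simps)
  also have "\<dots> =
      (((p + \<gamma>) * (p + \<gamma>) / p + (1 - (p + \<gamma>)) * (1 - (p + \<gamma>)) / (1 - p)) ^ n
      + 2 * ((p + \<gamma>) * (p - \<gamma>) / p + (1 - (p + \<gamma>)) * (1 - (p - \<gamma>)) / (1 - p)) ^ n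
      + ((p - \<gamma>) * (p - \<gamma>) / p + (1 - (p - \<gamma>)) * (1 - (p - \<gamma>)) / (1 - p)) ^ n) / 4"
    unfolding sum_divide_distrib[symmetric] sum.distrib sum_distrib_left[symmetric] cross ..
  also have "(p + \<gamma>) * (p + \<gamma>) / p + (1 - (p + \<gamma>)) * (1 - (p + \<gamma>)) / (1 - p) = 1 + \<gamma>\<^sup>2 / (p * (1 - p))"
    using p by (simp add: divide_simps power2_eq_square) algebra
  also have "(p - \<gamma>) * (p - \<gamma>) / p + (1 - (p - \<gamma>)) * (1 - (p - \<gamma>)) / (1 - p) = 1 + \<gamma>\<^sup>2 / (p * (1 - p))"
    using p by (simp add: divide_simps power2_eq_square) algebra
  also have "(p + \<gamma>) * (p - \<gamma>) / p + (1 - (p + \<gamma>)) * (1 - (p - \<gamma>)) / (1 - p) = 1 - \<gamma>\<^sup>2 / (p * (1 - p))"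
    using p by (simp add: divide_simps power2_eq_square) algebra
  finally show ?thesis
    by simp
qed

text \<open>The terms linear in \<open>n * u\<close> cancel between the two powers, which leaves a
  quadratic excess: this is the gain from symmetrizing the shift.\<close>

lemma symmetric_power_bound:
  fixes u :: real
  assumes u: "0 \<le> u" "u \<le> 1" and nu: "n * u \<le> 1"
  shows "((1 + u) ^ n + (1 - u) ^ n) / 2 \<le> 1 + (n * u)\<^sup>2"
proof -
  let ?x = "n * u"
  have x: "0 \<le> ?x" "?x \<le> 1"
    using u nu by auto
  have "(1 + u) ^ n \<le> exp u ^ n"
    using u by (intro power_mono) auto
  also have "\<dots> \<le> 1 + ?x + ?x\<^sup>2"
    unfolding exp_of_nat_mult[symmetric] using x by (rule exp_bound)
  finally have plus: "(1 + u) ^ n \<le> 1 + ?x + ?x\<^sup>2" .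
  have "(1 - u) ^ n \<le> exp (- u) ^ n"
    using u exp_minus_ge[of u] by (intro power_mono) auto
  also have "\<dots> = 1 / exp ?x"
    by (simp add: exp_minus exp_of_nat_mult power_inverse divide_inverse)
  also have "\<dots> \<le> 1 / (1 + ?x)"
    using x by (intro divide_left_mono mult_pos_pos exp_ge_add_one_self) auto
  also have "\<dots> \<le> 1 - ?x + ?x\<^sup>2"
  proof -
    have "(1 - ?x + ?x\<^sup>2) * (1 + ?x) = 1 + ?x ^ 3"
      by algebra
    also have "\<dots> \<ge> 1"
      using x(1) by simp
    finally show ?thesis
      using x by (simp add: pos_divide_le_eq)
  qed
  finally have minus: "(1 - u) ^ n \<le> 1 - ?x + ?x\<^sup>2" .
  show ?thesis
    using add_mono[OF plus minus] by simp
qed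

text \<open>Every choice of signs has the same distance from \<open>p\<close>, so none is bad and
  \<open>\<beta> = 0\<close>. Assumption \<open>sum\<close> keeps the product of the chi-square
  factors close to 1.\<close>

lemma undetectable_symmetric_shift:
  assumes p: "\<And>j. j \<in> {1..N} \<Longrightarrow> p j \<in> {0..1/2}"
    and gam: "\<And>j. j \<in> {1..N} \<Longrightarrow> 0 \<le> \<gamma> j \<and> \<gamma> j \<le> p j"
    and eta: "0 \<le> \<eta>" "\<eta> < 1"
    and sum: "(real n)\<^sup>2 * (\<Sum>j\<in>{1..N}. ((\<gamma> j)\<^sup>2 / p j)\<^sup>2) \<le> (1 - \<eta>)\<^sup>2 / 256"
  shows "undetectable \<eta> t n N p \<psi> ((\<Sum>j\<in>{1..N}. \<gamma> j powr t) powr (1 / t))"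
proof (rule two_point_prior[where \<beta> = 0 and w = "\<lambda>_. 1/2"])
  define \<tau> where "\<tau> = 1 - \<eta>"
  define k where "k = \<tau>\<^sup>2 / 256"
  have tau: "0 < \<tau>" "\<tau> \<le> 1"
    using eta by (auto simp: \<tau>_def)
  have k: "0 \<le> k" "k \<le> 1 / 256"
    using tau power_le_one[of \<tau> 2] by (auto simp: k_def)
  show p': "p j \<in> {0..1}" "p j + \<gamma> j \<in> {0..1}" "p j - \<gamma> j \<in> {0..1}" if "j \<in> {1..N}" for j
    using p[OF that] gam[OF that] by auto
  show "(\<Sum>s\<in>{s\<in>columns N. \<not> (\<Sum>j\<in>{1..N}. \<gamma> j powr t) powr (1 / t)
        \<le> lnorm t N (\<lambda>j. (if s j then p j + \<gamma> j else p j - \<gamma> j) - p j)}.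
        prior_weight N (\<lambda>_. 1/2) s) \<le> 0"
  proof -
    have "lnorm t N (\<lambda>j. (if s j then p j + \<gamma> j else p j - \<gamma> j) - p j) =
        (\<Sum>j\<in>{1..N}. \<gamma> j powr t) powr (1 / t)" for s
      unfolding lnorm_def using gam
      by (intro arg_cong[where f = "\<lambda>x. x powr (1 / t)"] sum.cong) auto
    then show ?thesis
      by simp
  qed
  \<comment> \<open>The factor 4 is the square of the 2 lost in bounding \<open>1 - p j\<close> from
    below by \<open>1 / 2\<close>.\<close>
  have col: "0 \<le> (\<Sum>y\<in>columns n. (col_mixture n (1/2) (p j + \<gamma> j) (p j - \<gamma> j) y)\<^sup>2 / col_weight n (p j) y)
      \<and> (\<Sum>y\<in>columns n. (col_mixture n (1/2) (p j + \<gamma> j) (p j - \<gamma> j) y)\<^sup>2 / col_weight n (p j) y)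
      \<le> exp (4 * ((real n)\<^sup>2 * ((\<gamma> j)\<^sup>2 / p j)\<^sup>2))" if j: "j \<in> {1..N}" for j
  proof
    show "0 \<le> (\<Sum>y\<in>columns n. (col_mixture n (1/2) (p j + \<gamma> j) (p j - \<gamma> j) y)\<^sup>2 / col_weight n (p j) y)"
      using p[OF j] by (intro sum_nonneg divide_nonneg_nonneg col_weight_nonneg) auto
    show "(\<Sum>y\<in>columns n. (col_mixture n (1/2) (p j + \<gamma> j) (p j - \<gamma> j) y)\<^sup>2 / col_weight n (p j) y)
      \<le> exp (4 * ((real n)\<^sup>2 * ((\<gamma> j)\<^sup>2 / p j)\<^sup>2))"
    proof (cases "p j = 0")
      case True
      then have "\<gamma> j = 0"
        using gam[OF j] by auto
      then have "(col_mixture n (1/2) (p j + \<gamma> j) (p j - \<gamma> j) y)\<^sup>2 / col_weight n (p j) y = col_weight n (p j) y" for y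
        using True by (simp add: col_mixture_def power2_eq_square)
      then show ?thesis
        using True by (simp add: sum_col_weight)
    next
      case False
      define u where "u = (\<gamma> j)\<^sup>2 / (p j * (1 - p j))"
      have pj: "0 < p j" "p j \<le> 1/2"
        using False p[OF j] by auto
      have g0: "0 \<le> \<gamma> j" "\<gamma> j \<le> p j"
        using gam[OF j] by auto
      have u0: "0 \<le> u"
        using pj by (simp add: u_def)
      have u2: "u \<le> 2 * ((\<gamma> j)\<^sup>2 / p j)"
      proof -
        have "(\<gamma> j)\<^sup>2 * p j \<le> (\<gamma> j)\<^sup>2 * (1 / 2)"
          using pj by (intro mult_left_mono) auto
        then show ?thesis
          using pj by (simp add: u_def field_simps)
      qed
      have u1: "u \<le> 1"
      proof -
        have "(\<gamma> j)\<^sup>2 \<le> p j * p j"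
          using g0 by (simp add: power2_eq_square mult_mono)
        also have "\<dots> \<le> p j * (1 - p j)"
          using pj by (intro mult_left_mono) auto
        finally show ?thesis
          using pj by (simp add: u_def)
      qed
      have "(n * u)\<^sup>2 \<le> (n * (2 * ((\<gamma> j)\<^sup>2 / p j)))\<^sup>2"
        using u0 u2 by (intro power_mono mult_left_mono mult_nonneg_nonneg) auto
      then have nu2: "(n * u)\<^sup>2 \<le> 4 * ((real n)\<^sup>2 * ((\<gamma> j)\<^sup>2 / p j)\<^sup>2)"
        by (simp only: power_mult_distrib) simp
      have "((\<gamma> j)\<^sup>2 / p j)\<^sup>2 \<le> (\<Sum>j\<in>{1..N}. ((\<gamma> j)\<^sup>2 / p j)\<^sup>2)"
        using j by (intro member_le_sum) auto
      then have "(real n)\<^sup>2 * ((\<gamma> j)\<^sup>2 / p j)\<^sup>2 \<le> (real n)\<^sup>2 * (\<Sum>j\<in>{1..N}. ((\<gamma> j)\<^sup>2 / p j)\<^sup>2)"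
        by (intro mult_left_mono) auto
      then have "(n * u)\<^sup>2 \<le> 1"
        using nu2 sum k unfolding \<tau>_def[symmetric] k_def[symmetric] by linarith
      then have "n * u \<le> 1"
        using power2_le_imp_le[of "n * u" 1] by simp
      then have "((1 + u) ^ n + (1 - u) ^ n) / 2 \<le> 1 + (n * u)\<^sup>2"
        using u0 u1 by (intro symmetric_power_bound)
      also have "\<dots> \<le> exp (4 * ((real n)\<^sup>2 * ((\<gamma> j)\<^sup>2 / p j)\<^sup>2))"
        using nu2 exp_ge_add_one_self[of "4 * ((real n)\<^sup>2 * ((\<gamma> j)\<^sup>2 / p j)\<^sup>2)"] by linarith
      finally show ?thesis
        using pj unfolding u_def by (subst chi_square_symmetric_column) auto
    qed
  qed
  have "(\<Prod>j\<in>{1..N}. \<Sum>y\<in>columns n.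
        (col_mixture n (1/2) (p j + \<gamma> j) (p j - \<gamma> j) y)\<^sup>2 / col_weight n (p j) y)
      \<le> (\<Prod>j\<in>{1..N}. exp (4 * ((real n)\<^sup>2 * ((\<gamma> j)\<^sup>2 / p j)\<^sup>2)))"
    using col by (intro prod_mono) auto
  also have "\<dots> = exp (4 * ((real n)\<^sup>2 * (\<Sum>j\<in>{1..N}. ((\<gamma> j)\<^sup>2 / p j)\<^sup>2)))"
    by (simp add: exp_sum[symmetric] sum_distrib_left)
  also have "\<dots> \<le> exp (4 * k)"
    using sum by (simp add: k_def \<tau>_def)
  also have "\<dots> \<le> 1 + 4 * k + (4 * k)\<^sup>2"
    using k by (intro exp_bound) auto
  also have "\<dots> \<le> 1 + 8 * k"
    using k mult_left_mono[of k "1/4" "16 * k"] by (simp add: power2_eq_square)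
  finally have chi: "(\<Prod>j\<in>{1..N}. \<Sum>y\<in>columns n.
        (col_mixture n (1/2) (p j + \<gamma> j) (p j - \<gamma> j) y)\<^sup>2 / col_weight n (p j) y) \<le> 1 + 8 * k" .
  show "1 - (\<tau> / 2 + 8 * k / (2 * \<tau>)) \<le> (\<Sum>z\<in>PiE {1..N} (\<lambda>_. columns n).
        min (\<Prod>j\<in>{1..N}. col_mixture n (1/2) (p j + \<gamma> j) (p j - \<gamma> j) (z j))
            (\<Prod>j\<in>{1..N}. col_weight n (p j) (z j)))"
  proof (rule affinity_chi_square[OF _ tau(1) _ _ _ _ chi])
    fix j y assume j: "j \<in> {1..N}" and zero: "col_weight n (p j) y = 0"
    \<comment> \<open>Since \<open>p j \<le> 1/2\<close>, a column has weight zero only if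
      \<open>p j = 0\<close>; then the shift vanishes as well and the mixture equals the null
      weight.\<close>
    have "p j = 0"
    proof (rule ccontr)
      assume "p j \<noteq> 0"
      then have "0 < col_weight n (p j) y"
        unfolding col_weight_def using p[OF j] by (intro prod_pos) auto
      then show False
        using zero by simp
    qed
    moreover from this have "\<gamma> j = 0"
      using gam[OF j] by auto
    ultimately show "col_mixture n (1/2) (p j + \<gamma> j) (p j - \<gamma> j) y = 0"
      using zero by (simp add: col_mixture_def)
  qed (use p' in auto)
  \<comment> \<open>With \<open>k = \<tau>^2 / 256\<close> the total loss is
    \<open>\<tau> / 2 + \<tau> / 64\<close>, which is below
    \<open>\<tau> = 1 - \<eta>\<close>.\<close>
  have "8 * k / (2 * \<tau>) = \<tau> / 64"
    using tau by (simp add: k_def power2_eq_square)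
  then show "\<tau> / 2 + 8 * k / (2 * \<tau>) + 2 * 0 < 1 - \<eta>"
    using tau by (simp add: \<tau>_def[symmetric])
qed (use eta in auto)

subsection \<open>Sparse perturbations\<close>

text \<open>Only the zero column and the \<open>n\<close> columns with a single one are kept. The
  mixture has mean \<open>p\<close>, so the mass \<open>n * p\<close> missing from the zero column
  is recovered from the single ones, up to the second-order loss
  \<open>n^2 * p * \<gamma>\<close>.\<close>

lemma sparse_column_affinity:
  assumes p: "0 \<le> p" "p \<le> \<gamma>" and gam: "0 < \<gamma>" "\<gamma> \<le> 1"
  shows "1 - (real n)\<^sup>2 * p * \<gamma> \<le>
    (\<Sum>y\<in>columns n. min (col_mixture n (p / \<gamma>) \<gamma> 0 y) (col_weight n p y))"
proof -
  let ?m = "\<lambda>y. min (col_mixture n (p / \<gamma>) \<gamma> 0 y) (col_weight n p y)"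
  define zero where "zero = restrict (\<lambda>_::nat. False) {1..n}"
  define single where "single l = restrict (\<lambda>k. k = l) {1..n}" for l
  have w: "p / \<gamma> \<in> {0..1}"
    using p gam by auto
  have nn: "0 \<le> ?m y" for y
    using col_mixture_nonneg[OF w, of \<gamma> 0] col_weight_nonneg[of p] p gam by auto
  have cw_zero: "col_weight n \<theta> zero = (1 - \<theta>) ^ n" for \<theta>
    by (simp add: col_weight_def zero_def)
  have cw_single: "col_weight n \<theta> (single l) = \<theta> * (1 - \<theta>) ^ (n - 1)" if "l \<in> {1..n}" for \<theta> l
  proof -
    have "col_weight n \<theta> (single l) = (\<Prod>k\<in>{1..n}. if k = l then \<theta> else 1 - \<theta>)"
      unfolding col_weight_def by (intro prod.cong) (auto simp: single_def)
    also have "\<dots> = \<theta> * (\<Prod>k\<in>{1..n} - {l}. if k = l then \<theta> else 1 - \<theta>)"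
      using that by (subst prod.remove[of _ l]) auto
    also have "(\<Prod>k\<in>{1..n} - {l}. if k = l then \<theta> else 1 - \<theta>) = (\<Prod>k\<in>{1..n} - {l}. 1 - \<theta>)"
      by (intro prod.cong) auto
    finally show ?thesis
      using that by simp
  qed
  have inj: "inj_on single {1..n}"
  proof
    fix k l assume kl: "k \<in> {1..n}" "l \<in> {1..n}" "single k = single l"
    then have "single k k = single l k"
      by simp
    then show "k = l"
      using kl by (simp add: single_def)
  qed
  have notin: "zero \<notin> single ` {1..n}"
  proof
    assume "zero \<in> single ` {1..n}"
    then obtain l where l: "l \<in> {1..n}" "zero = single l"
      by auto
    then have "zero l = single l l"
      by simp
    then show False
      using l(1) by (simp add: zero_def single_def)
  qed
  have sub: "insert zero (single ` {1..n}) \<subseteq> columns n"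
    by (auto simp: columns_def zero_def single_def)
  have bern: "1 - real n * x \<le> (1 - x) ^ n" if "x \<le> 1" for x
    using Bernoulli_inequality[of "- x" n] that by simp
  have mzero: "1 - real n * p \<le> ?m zero"
  proof (rule min.boundedI)
    show "1 - real n * p \<le> col_weight n p zero"
      unfolding cw_zero using p gam by (intro bern) auto
    \<comment> \<open>Averaging the Bernoulli bound for \<open>(1 - \<gamma>) ^ n\<close> with
      weight \<open>p / \<gamma>\<close> gives the same lower bound as for the null.\<close>
    have "1 - real n * p = p / \<gamma> * (1 - real n * \<gamma>) + (1 - p / \<gamma>)"
      using gam by (simp add: field_simps)
    also have "\<dots> \<le> col_mixture n (p / \<gamma>) \<gamma> 0 zero"
      unfolding col_mixture_def cw_zero using w bern[OF gam(2)]
      by (intro add_mono mult_left_mono) auto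
    finally show "1 - real n * p \<le> col_mixture n (p / \<gamma>) \<gamma> 0 zero" .
  qed
  have msingle: "p * (1 - real n * \<gamma>) \<le> ?m (single l)" if l: "l \<in> {1..n}" for l
  proof -
    \<comment> \<open>A single column has exponent \<open>n - 1\<close>; the bound is taken for
      exponent \<open>n\<close> so that the losses add up to exactly
      \<open>n^2 * p * \<gamma>\<close>.\<close>
    have "1 - real n * \<gamma> \<le> (1 - \<gamma>) ^ n"
      by (rule bern[OF gam(2)])
    also have "\<dots> \<le> (1 - \<gamma>) ^ (n - 1)"
      using gam by (intro power_decreasing) auto
    finally have a: "p * (1 - real n * \<gamma>) \<le> p * (1 - \<gamma>) ^ (n - 1)"
      using p by (intro mult_left_mono)
    also have "\<dots> \<le> p * (1 - p) ^ (n - 1)"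
      using p gam by (intro mult_left_mono power_mono) auto
    finally show ?thesis
      using a gam by (simp add: col_mixture_def cw_single[OF l])
  qed
  have "1 - (real n)\<^sup>2 * p * \<gamma> = (1 - real n * p) + (\<Sum>l\<in>{1..n}. p * (1 - real n * \<gamma>))"
    by (simp add: algebra_simps power2_eq_square)
  also have "\<dots> \<le> ?m zero + (\<Sum>l\<in>{1..n}. ?m (single l))"
    by (intro add_mono sum_mono mzero msingle)
  also have "\<dots> = (\<Sum>y\<in>insert zero (single ` {1..n}). ?m y)"
    using notin by (simp add: sum.reindex[OF inj] o_def del: One_nat_def)
  also have "\<dots> \<le> (\<Sum>y\<in>columns n. ?m y)"
    using sub nn by (intro sum_mono2) auto
  finally show ?thesis .
qed

text \<open>Chernoff's method for the lower tail: each hit is weighted by \<open>1/2\<close>, a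
  factor with mean \<open>1 - w j / 2 \<le> exp (- w j / 2)\<close>. On the event,
  \<open>2 powr (\<mu> / 4)\<close> outweighs these factors, and it costs at most
  \<open>exp (\<mu> / 4)\<close>.\<close>

lemma few_hits_unlikely:
  assumes w: "\<And>j. j \<in> {1..N} \<Longrightarrow> w j \<in> {0..1}" and T: "T \<subseteq> {1..N}"
  shows "(\<Sum>s\<in>{s\<in>columns N. card {j\<in>T. s j} < (\<Sum>j\<in>T. w j) / 4}. prior_weight N w s)
    \<le> exp (- (\<Sum>j\<in>T. w j) / 4)"
proof -
  define \<mu> where "\<mu> = (\<Sum>j\<in>T. w j)"
  have finT: "finite T"
    using T finite_subset by blast
  have mu: "0 \<le> \<mu>"
    unfolding \<mu>_def using w T by (intro sum_nonneg) auto
  define h :: "nat \<Rightarrow> bool \<Rightarrow> real" where "h j e = (if j \<in> T \<and> e then 1/2 else 1)" for j e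
  have W: "0 \<le> prior_weight N w s" for s
    unfolding prior_weight_def using w by (intro prod_nonneg) auto
  have hprod: "(\<Prod>j\<in>{1..N}. h j (s j)) = (1/2) ^ card {j\<in>T. s j}" for s
  proof -
    have "(\<Prod>j\<in>{1..N}. h j (s j)) = (\<Prod>j\<in>{j\<in>T. s j}. 1/2)"
      by (rule prod.mono_neutral_cong_right) (use T in \<open>auto simp: h_def\<close>)
    then show ?thesis
      by simp
  qed
  have "(\<Sum>s\<in>{s\<in>columns N. card {j\<in>T. s j} < \<mu> / 4}. prior_weight N w s)
     \<le> (\<Sum>s\<in>{s\<in>columns N. card {j\<in>T. s j} < \<mu> / 4}.
          2 powr (\<mu> / 4) * (prior_weight N w s * (\<Prod>j\<in>{1..N}. h j (s j))))"
  proof (intro sum_mono)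
    fix s assume "s \<in> {s\<in>columns N. card {j\<in>T. s j} < \<mu> / 4}"
    then have "2 powr real (card {j\<in>T. s j}) \<le> (2::real) powr (\<mu> / 4)"
      by (intro powr_mono) auto
    then have "1 \<le> 2 powr (\<mu> / 4) * (1/2) ^ card {j\<in>T. s j}"
      by (simp add: powr_realpow power_divide)
    then show "prior_weight N w s \<le> 2 powr (\<mu> / 4) * (prior_weight N w s * (\<Prod>j\<in>{1..N}. h j (s j)))"
      unfolding hprod using mult_left_mono[OF _ W, of 1 "2 powr (\<mu> / 4) * (1/2) ^ card {j\<in>T. s j}" s]
      by (simp add: mult.left_commute)
  qed
  also have "\<dots> \<le> (\<Sum>s\<in>columns N. 2 powr (\<mu> / 4) * (prior_weight N w s * (\<Prod>j\<in>{1..N}. h j (s j))))"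
    unfolding hprod using W by (intro sum_mono2) auto
  also have "\<dots> = 2 powr (\<mu> / 4) * (\<Sum>s\<in>columns N. \<Prod>j\<in>{1..N}. (if s j then w j else 1 - w j) * h j (s j))"
    unfolding prior_weight_def prod.distrib sum_distrib_left ..
  also have "(\<Sum>s\<in>columns N. \<Prod>j\<in>{1..N}. (if s j then w j else 1 - w j) * h j (s j)) =
      (\<Prod>j\<in>{1..N}. w j * h j True + (1 - w j) * h j False)"
    using sum_prod_columns[where n = N and f = "\<lambda>j e. (if e then w j else 1 - w j) * h j e"] by simp
  also have "\<dots> \<le> (\<Prod>j\<in>{1..N}. exp (if j \<in> T then - w j / 2 else 0))"
  proof (intro prod_mono conjI)
    fix j assume j: "j \<in> {1..N}"
    show "0 \<le> w j * h j True + (1 - w j) * h j False"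
      using w[OF j] by (simp add: h_def)
    show "w j * h j True + (1 - w j) * h j False \<le> exp (if j \<in> T then - w j / 2 else 0)"
      using exp_ge_add_one_self[of "- w j / 2"] by (simp add: h_def)
  qed
  also have "\<dots> = exp (\<Sum>j\<in>{1..N}. if j \<in> T then - w j / 2 else 0)"
    by (simp add: exp_sum)
  also have "(\<Sum>j\<in>{1..N}. if j \<in> T then - w j / 2 else 0) = (\<Sum>j\<in>T. - w j / 2)"
    by (rule sum.mono_neutral_cong_right) (use T in auto)
  also have "\<dots> = - \<mu> / 2"
    by (simp add: \<mu>_def sum_negf sum_divide_distrib)
  finally have *: "(\<Sum>s\<in>{s\<in>columns N. card {j\<in>T. s j} < \<mu> / 4}. prior_weight N w s)
      \<le> 2 powr (\<mu> / 4) * exp (- \<mu> / 2)"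
    by (simp add: mult_left_mono)
  have "2 powr (\<mu> / 4) = exp (\<mu> / 4 * ln 2)"
    by (simp add: powr_def)
  also have "\<dots> \<le> exp (\<mu> / 4)"
    using mu ln_2_less_1 mult_left_mono[of "ln 2" 1 "\<mu> / 4"] by simp
  finally have "2 powr (\<mu> / 4) * exp (- \<mu> / 2) \<le> exp (\<mu> / 4) * exp (- \<mu> / 2)"
    by (intro mult_right_mono) auto
  also have "\<dots> = exp (- \<mu> / 4)"
    by (simp add: exp_add[symmetric])
  finally show ?thesis
    using * unfolding \<mu>_def by linarith
qed

text \<open>About \<open>s1 / \<gamma>\<close> coordinates jump to \<open>\<gamma>\<close>, so the
  distance is of order \<open>s1 powr (1 / t) * \<gamma> powr (1 - 1 / t)\<close>, which is the
  stated rate for \<open>\<gamma>\<close> of order \<open>1 / (n^2 * s1)\<close>. The condition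
  \<open>1 \<le> n * s1\<close> provides enough jumps for concentration.\<close>

lemma undetectable_sparse_prior:
  assumes p: "\<And>j. j \<in> {1..N} \<Longrightarrow> p j \<in> {0..1/2}" and T: "T \<subseteq> {1..N}"
    and n: "1 \<le> n" and t: "1 \<le> t" "t \<le> 2" and eta: "0 \<le> \<eta>" "\<eta> < 1"
    and s1: "s1 = (\<Sum>j\<in>T. p j)" "1 \<le> n * s1"
    and g: "g = (1 - \<eta>) / 32"
    and sq: "(\<Sum>j\<in>T. (p j)\<^sup>2) \<le> g / 4 / (real n)\<^sup>2"
  shows "undetectable \<eta> t n N p \<psi> (g / 32 * (s1 powr ((2 - t) / t) / n powr ((2 * t - 2) / t)))"
proof -
  have g01: "0 < g" "g \<le> 1/32"
    using g eta by auto
  have n0: "0 < real n"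
    using n by simp
  have s0: "0 < s1"
    using s1(2) n0 by (smt (verit) mult_nonneg_nonpos)
  \<comment> \<open>Chosen so that the column losses \<open>n^2 * p j * \<gamma>\<close> sum to
    \<open>g\<close> over \<open>T\<close>.\<close>
  define \<gamma> where "\<gamma> = g / ((real n)\<^sup>2 * s1)"
  have gam: "0 < \<gamma>"
    using g01 n0 s0 by (simp add: \<gamma>_def)
  have "1 \<le> (real n) * (n * s1)"
    using n s1(2) mult_mono[of 1 "real n" 1 "n * s1"] by simp
  then have ns: "1 \<le> (real n)\<^sup>2 * s1"
    by (simp add: power2_eq_square mult.assoc)
  have gam1: "\<gamma> \<le> 1"
    unfolding \<gamma>_def using g01 ns by simp
  have finT: "finite T"
    using T finite_subset by blast
  \<comment> \<open>On \<open>T'\<close> a jump moves the coordinate by at least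
    \<open>\<gamma> / 2\<close>, and its probability \<open>p j / \<gamma>\<close> is at most
    \<open>1/2\<close>.\<close>
  define T' where "T' = {j\<in>T. p j \<le> \<gamma> / 2}"
  have T': "T' \<subseteq> {1..N}" "T' \<subseteq> T" "finite T'"
    using T finT by (auto simp: T'_def)
  define a where "a j = (if j \<in> T' then \<gamma> else p j)" for j
  define b where "b j = (if j \<in> T' then 0 else p j)" for j
  define w where "w j = (if j \<in> T' then p j / \<gamma> else 1 / 2)" for j
  define \<mu> where "\<mu> = (\<Sum>j\<in>T'. w j)"
  have small: "p j \<le> \<gamma> / 2" if "j \<in> T'" for j
    using that by (simp add: T'_def)
  have p01: "p j \<in> {0..1}" if "j \<in> {1..N}" for j
    using p[OF that] by auto
  have a01: "a j \<in> {0..1}" if "j \<in> {1..N}" for j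
    using p01[OF that] gam gam1 by (auto simp: a_def)
  have b01: "b j \<in> {0..1}" if "j \<in> {1..N}" for j
    using p01[OF that] by (auto simp: b_def)
  have w01: "w j \<in> {0..1}" if "j \<in> {1..N}" for j
    using p01[OF that] small[of j] gam by (auto simp: w_def)
  \<comment> \<open>Above \<open>\<gamma> / 2\<close> one has
    \<open>p j \<le> (p j)^2 * (2 / \<gamma>)\<close>, so by \<open>sq\<close> the discarded
    coordinates carry at most half of \<open>s1\<close>.\<close>
  have "(\<Sum>j\<in>T - T'. p j) \<le> (\<Sum>j\<in>T - T'. (p j)\<^sup>2 * (2 / \<gamma>))"
  proof (intro sum_mono)
    fix j assume j: "j \<in> T - T'"
    then have "\<gamma> / 2 \<le> p j"
      by (auto simp: T'_def)
    moreover have "0 \<le> p j"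
      using p01 j T by auto
    ultimately have "p j * (\<gamma> / 2) \<le> p j * p j"
      by (intro mult_left_mono)
    then show "p j \<le> (p j)\<^sup>2 * (2 / \<gamma>)"
      using gam by (simp add: field_simps power2_eq_square)
  qed
  also have "\<dots> \<le> (\<Sum>j\<in>T. (p j)\<^sup>2 * (2 / \<gamma>))"
    using finT gam by (intro sum_mono2) auto
  also have "\<dots> \<le> g / 4 / (real n)\<^sup>2 * (2 / \<gamma>)"
    unfolding sum_distrib_right[symmetric] using sq gam by (intro mult_right_mono) auto
  also have "\<dots> = s1 / 2"
    using g01 n0 s0 by (simp add: \<gamma>_def)
  finally have "s1 / 2 \<le> (\<Sum>j\<in>T'. p j)"
    using sum.subset_diff[OF T'(2) finT, of p] s1(1) by linarith
  then have mu: "s1 / (2 * \<gamma>) \<le> \<mu>"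
    using gam by (simp add: \<mu>_def w_def sum_divide_distrib[symmetric] field_simps)
  \<comment> \<open>Since \<open>s1 / (2 * \<gamma>) = (n * s1)^2 / (2 * g)\<close>, the mean number
    of jumps is at least \<open>1 / (2 * g)\<close>.\<close>
  have "1 \<le> (n * s1)\<^sup>2"
    using s1(2) by simp
  then have "1 / (2 * g) \<le> s1 / (2 * \<gamma>)"
    using g01 n0 s0 by (simp add: \<gamma>_def field_simps power2_eq_square)
  then have mu_large: "1 / (2 * g) \<le> \<mu>"
    using mu by linarith
  show ?thesis
  proof (rule two_point_prior[where a = a and b = b and w = w and p = p, OF p01 a01 b01 w01])
    have "1 - (\<Sum>j\<in>{1..N}. if j \<in> T' then (real n)\<^sup>2 * p j * \<gamma> else 0)
      \<le> (\<Sum>z\<in>PiE {1..N} (\<lambda>_. columns n).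
        min (\<Prod>j\<in>{1..N}. col_mixture n (w j) (a j) (b j) (z j))
            (\<Prod>j\<in>{1..N}. col_weight n (p j) (z j)))"
    proof (rule affinity_by_columns[OF p01 a01 b01 w01])
      fix j assume j: "j \<in> {1..N}"
      have "(real n)\<^sup>2 * p j * \<gamma> \<le> 1" if "j \<in> T'"
      proof -
        have "p j \<le> s1"
          unfolding s1(1) using that T' finT p01 T by (intro member_le_sum) auto
        then have "(real n)\<^sup>2 * p j * \<gamma> \<le> (real n)\<^sup>2 * s1 * \<gamma>"
          using gam by (intro mult_right_mono mult_left_mono) auto
        also have "\<dots> \<le> 1"
          using g01 n0 s0 by (simp add: \<gamma>_def)
        finally show ?thesis .
      qed
      then show "(if j \<in> T' then (real n)\<^sup>2 * p j * \<gamma> else 0) \<in> {0..1}"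
        using p01[OF j] gam by auto
      show "1 - (if j \<in> T' then (real n)\<^sup>2 * p j * \<gamma> else 0) \<le>
        (\<Sum>y\<in>columns n. min (col_mixture n (w j) (a j) (b j) y) (col_weight n (p j) y))"
      proof (cases "j \<in> T'")
        case True
        have "1 - (real n)\<^sup>2 * p j * \<gamma> \<le>
            (\<Sum>y\<in>columns n. min (col_mixture n (p j / \<gamma>) \<gamma> 0 y) (col_weight n (p j) y))"
          using p01[OF j] small[OF True] gam gam1 by (intro sparse_column_affinity) auto
        then show ?thesis
          using True by (simp add: w_def a_def b_def)
      next
        case False
        then have "col_mixture n (w j) (a j) (b j) y = col_weight n (p j) y" for y
          by (simp add: w_def a_def b_def col_mixture_def)
        then show ?thesis
          using False by (simp add: sum_col_weight)
      qed
    qed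
    moreover have "(\<Sum>j\<in>{1..N}. if j \<in> T' then (real n)\<^sup>2 * p j * \<gamma> else 0) = (\<Sum>j\<in>T'. (real n)\<^sup>2 * p j * \<gamma>)"
      by (rule sum.mono_neutral_cong_right) (use T' in auto)
    moreover have "(\<Sum>j\<in>T'. (real n)\<^sup>2 * p j * \<gamma>) \<le> g"
    proof -
      have "(\<Sum>j\<in>T'. (real n)\<^sup>2 * p j * \<gamma>) \<le> (\<Sum>j\<in>T. (real n)\<^sup>2 * p j * \<gamma>)"
        using T' T finT gam p01 by (intro sum_mono2) auto
      also have "\<dots> = (real n)\<^sup>2 * s1 * \<gamma>"
        by (simp add: s1(1) sum_distrib_left sum_distrib_right)
      also have "\<dots> = g"
        using n0 s0 by (simp add: \<gamma>_def)
      finally show ?thesis .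
    qed
    ultimately show "1 - g \<le> (\<Sum>z\<in>PiE {1..N} (\<lambda>_. columns n).
        min (\<Prod>j\<in>{1..N}. col_mixture n (w j) (a j) (b j) (z j))
            (\<Prod>j\<in>{1..N}. col_weight n (p j) (z j)))"
      by linarith
  next
    let ?d = "g / 32 * (s1 powr ((2 - t) / t) / n powr ((2 * t - 2) / t))"
    have far: "?d \<le> lnorm t N (\<lambda>j. (if s j then a j else b j) - p j)"
      if hits: "\<mu> / 4 \<le> card {j\<in>T'. s j}" for s
    proof -
      define e where "e = (t - 1) / t"
      have e: "0 \<le> e" "e \<le> 1"
        using t by (auto simp: e_def field_simps)
      have exps: "(2 - t) / t = 1 / t - e" "(2 * t - 2) / t = 2 * e"
        using t by (auto simp: e_def field_simps)
      \<comment> \<open>By \<open>mu\<close>, \<open>s1 / (8 * \<gamma>)\<close> is at most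
        \<open>\<mu> / 4\<close>, the assumed number of jumps; each adds at least
        \<open>(\<gamma> / 2) powr t\<close>, hence \<open>\<gamma> powr t / 4\<close> because
        \<open>t \<le> 2\<close>.\<close>
      have "s1 * \<gamma> powr (t - 1) / 32 = s1 / (8 * \<gamma>) * (\<gamma> powr t * (1 / 4))"
        using gam by (simp add: powr_diff)
      also have "\<dots> \<le> \<mu> / 4 * (\<gamma> powr t * (1 / 4))"
        using mu gam by (intro mult_right_mono) auto
      also have "\<dots> \<le> card {j\<in>T'. s j} * (\<gamma> powr t * (1 / 2) powr t)"
      proof (intro mult_mono hits)
        show "1 / 4 \<le> (1 / 2) powr t"
          using t powr_mono'[of t 2 "1/2"] by (simp add: power2_eq_square)
      qed auto
      also have "\<dots> = (\<Sum>j\<in>{j\<in>T'. s j}. (\<gamma> / 2) powr t)"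
        by (simp flip: powr_mult)
      also have "\<dots> \<le> (\<Sum>j\<in>{j\<in>T'. s j}. \<bar>(if s j then a j else b j) - p j\<bar> powr t)"
      proof (intro sum_mono powr_mono2)
        fix j assume j: "j \<in> {j\<in>T'. s j}"
        then have "\<gamma> / 2 \<le> a j - p j"
          using small[of j] by (simp add: a_def)
        then show "\<gamma> / 2 \<le> \<bar>(if s j then a j else b j) - p j\<bar>"
          using j abs_ge_self[of "a j - p j"] by auto
      qed (use t gam in auto)
      also have "\<dots> \<le> (\<Sum>j\<in>{1..N}. \<bar>(if s j then a j else b j) - p j\<bar> powr t)"
        using T' by (intro sum_mono2) auto
      finally have "(s1 * \<gamma> powr (t - 1) / 32) powr (1 / t)
          \<le> lnorm t N (\<lambda>j. (if s j then a j else b j) - p j)"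
        unfolding lnorm_def using t s0 by (intro powr_mono2) auto
      moreover have "?d \<le> (s1 * \<gamma> powr (t - 1) / 32) powr (1 / t)"
      proof -
        have "s1 powr ((2 - t) / t) / n powr ((2 * t - 2) / t) * g
            \<le> s1 powr (1 / t - e) / n powr (2 * e) * g powr e"
          unfolding exps using g01 e powr_mono'[of e 1 g] by (intro mult_left_mono) auto
        also have "n powr (2 * e) = ((real n)\<^sup>2) powr e"
          using n0 by (simp add: powr_powr flip: powr_numeral)
        also have "s1 powr (1 / t - e) / ((real n)\<^sup>2) powr e * g powr e = s1 powr (1 / t) * \<gamma> powr e"
          by (simp add: \<gamma>_def powr_diff powr_divide powr_mult)
        also have "\<dots> = (s1 * \<gamma> powr (t - 1)) powr (1 / t)"
          by (simp add: powr_mult powr_powr e_def)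
        finally have 1: "s1 powr ((2 - t) / t) / n powr ((2 * t - 2) / t) * g
          \<le> (s1 * \<gamma> powr (t - 1)) powr (1 / t)" .
        have 2: "1 / 32 \<le> (1 / 32 :: real) powr (1 / t)"
          using t powr_mono'[of "1 / t" 1 "1 / 32"] by simp
        have "?d = (s1 powr ((2 - t) / t) / n powr ((2 * t - 2) / t) * g) * (1 / 32)"
          by (simp add: mult_ac)
        also have "\<dots> \<le> (s1 * \<gamma> powr (t - 1)) powr (1 / t) * (1 / 32) powr (1 / t)"
          using g01 by (intro mult_mono 1 2) auto
        also have "\<dots> = (s1 * \<gamma> powr (t - 1) / 32) powr (1 / t)"
          by (simp flip: powr_mult)
        finally show ?thesis .
      qed
      ultimately show ?thesis
        by linarith
    qed
    have W: "0 \<le> prior_weight N w s" for s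
      unfolding prior_weight_def using w01 by (intro prod_nonneg) auto
    have "(\<Sum>s\<in>{s\<in>columns N. \<not> ?d \<le> lnorm t N (\<lambda>j. (if s j then a j else b j) - p j)}. prior_weight N w s)
      \<le> (\<Sum>s\<in>{s\<in>columns N. card {j\<in>T'. s j} < \<mu> / 4}. prior_weight N w s)"
      using far W by (intro sum_mono2) (auto simp: not_le[symmetric] simp del: not_le)
    also have "\<dots> \<le> exp (- \<mu> / 4)"
      unfolding \<mu>_def using w01 T'(1) by (intro few_hits_unlikely)
    also have "\<dots> \<le> exp (- (1 / (8 * g)))"
      using mu_large by (simp add: field_simps)
    also have "\<dots> \<le> 8 * g"
      using exp_ge_add_one_self[of "1 / (8 * g)"] g01
      by (simp add: exp_minus field_simps)
    finally show "(\<Sum>s\<in>{s\<in>columns N. \<not> ?d \<le> lnorm t N (\<lambda>j. (if s j then a j else b j) - p j)}.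
        prior_weight N w s) \<le> 8 * g" .
    \<comment> \<open>The choice \<open>g = (1 - \<eta>) / 32\<close> leaves room for the total
      \<open>17 * g\<close>.\<close>
    show "g + 2 * (8 * g) < 1 - \<eta>"
      using g eta by (simp add: field_simps)
  qed (use eta in auto)
qed

subsection \<open>The main term\<close>

text \<open>If \<open>n\<close> times the mass of \<open>T\<close> is below 1, the sparse prior may
  produce too few jumps. The two exponents of the rate add up to 1, so the rate is then at most
  \<open>1 / n\<close> and a single shift attains it.\<close>

lemma undetectable_tail:
  assumes p: "\<And>j. j \<in> {1..N} \<Longrightarrow> p j \<in> {0..1/2}" and T: "T \<subseteq> {1..N}"
    and N: "1 \<le> N" and n: "2 \<le> n" and t: "1 \<le> t" "t \<le> 2" and eta: "0 \<le> \<eta>" "\<eta> < 1"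
    and g: "g = (1 - \<eta>) / 32"
    and sq: "(\<Sum>j\<in>T. (p j)\<^sup>2) \<le> g / 4 / (real n)\<^sup>2"
  shows "undetectable \<eta> t n N p \<psi>
    (g / 32 * (rpow (\<Sum>j\<in>T. p j) ((2 - t) / t) / n powr ((2 * t - 2) / t)))"
proof (cases "1 \<le> n * (\<Sum>j\<in>T. p j)")
  case True
  then have "(\<Sum>j\<in>T. p j) > 0"
    by (smt (verit) mult_nonneg_nonpos of_nat_0_le_iff)
  then have "rpow (\<Sum>j\<in>T. p j) ((2 - t) / t) = (\<Sum>j\<in>T. p j) powr ((2 - t) / t)"
    by (simp add: rpow_def)
  then show ?thesis
    using undetectable_sparse_prior[OF p T _ t eta refl True g sq] n by simp
next
  case False
  have n0: "0 < real n"
    using n by simp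
  have g01: "0 < g" "g \<le> 1/32"
    using g eta by auto
  have s0: "0 \<le> (\<Sum>j\<in>T. p j)"
    using p T by (intro sum_nonneg) force
  have s1: "(\<Sum>j\<in>T. p j) \<le> 1 / n"
    using False n0 by (simp add: field_simps)
  \<comment> \<open>At \<open>t = 2\<close> the exponent is 0 and both sides are 1, by the
    convention in \<open>rpow\<close>.\<close>
  have "rpow (\<Sum>j\<in>T. p j) ((2 - t) / t) \<le> (1 / n) powr ((2 - t) / t)"
    using s0 s1 t n0 by (auto simp: rpow_def intro!: powr_mono2)
  then have "rpow (\<Sum>j\<in>T. p j) ((2 - t) / t) / n powr ((2 * t - 2) / t)
      \<le> (1 / n) powr ((2 - t) / t) / n powr ((2 * t - 2) / t)"
    by (intro divide_right_mono) auto
  also have "\<dots> = n powr (- ((2 - t) / t) - (2 * t - 2) / t)"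
    using n0 by (simp add: powr_diff powr_minus inverse_powr divide_inverse)
  also have "- ((2 - t) / t) - (2 * t - 2) / t = - 1"
    using t by (simp add: field_simps)
  also have "n powr (- 1) = 1 / n"
    using n0 by (simp add: powr_minus divide_inverse)
  finally have "g / 32 * (rpow (\<Sum>j\<in>T. p j) ((2 - t) / t) / n powr ((2 * t - 2) / t)) \<le> g / 32 * (1 / n)"
    using g01 by (intro mult_left_mono) auto
  also have "\<dots> \<le> g / n"
    using g01 n0 by (simp add: field_simps)
  finally have "g / 32 * (rpow (\<Sum>j\<in>T. p j) ((2 - t) / t) / n powr ((2 * t - 2) / t)) \<le> g / n" .
  moreover have "undetectable \<eta> t n N p \<psi> (g / n)"
    using g g01 eta t by (intro undetectable_single_shift p N n) auto
  ultimately show ?thesis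
    by (blast intro: undetectable_mono)
qed

text \<open>A shift proportional to \<open>p j powr (2 / (4 - t))\<close> maximizes the sum of
  \<open>\<gamma> j powr t\<close> under a bound on the sum of
  \<open>\<gamma> j ^ 4 / (p j)^2\<close>: both sums become multiples of the sum of
  \<open>p j powr r\<close>. The condition on \<open>\<nu>\<close> in \<open>Gp\<close> says that
  \<open>\<gamma> j \<le> p j\<close>.\<close>

lemma undetectable_head:
  assumes p: "\<And>j. j \<in> {1..N} \<Longrightarrow> p j \<in> {0..1/2}" and G: "G \<subseteq> {1..N}"
    and n: "1 \<le> n" and t: "1 \<le> t" "t \<le> 2" and eta: "0 \<le> \<eta>" "\<eta> < 1"
    and r: "r = 2 * t / (4 - t)" and S: "0 < S"
    and lam: "\<nu> = ((1 - \<eta>)\<^sup>2 / 256 / ((real n)\<^sup>2 * S)) powr (1 / 4)"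
    and Gp: "\<And>j. j \<in> G \<Longrightarrow> 0 < p j \<and> \<nu> \<le> p j powr ((2 - t) / (4 - t))"
    and upper: "(\<Sum>j\<in>G. p j powr r) \<le> S" and lower: "S / 2 \<le> (\<Sum>j\<in>G. p j powr r)"
  shows "undetectable \<eta> t n N p \<psi> ((1 - \<eta>) / 8 * sqrt (S powr (1 / r) / n))"
proof -
  define \<tau> where "\<tau> = 1 - \<eta>"
  have tau: "0 < \<tau>" "\<tau> \<le> 1"
    using eta by (auto simp: \<tau>_def)
  have n0: "0 < real n"
    using n by simp
  have r0: "0 < r"
    using t by (simp add: r)
  have finG: "finite G"
    using G finite_subset by blast
  have lam0: "0 < \<nu>"
    using tau n0 S by (simp add: lam \<tau>_def[symmetric])
  \<comment> \<open>Thus \<open>n^2 * \<nu>^4 * S\<close> is exactly the budget of the symmetric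
    shift.\<close>
  have lam4: "\<nu> ^ 4 = \<tau>\<^sup>2 / 256 / ((real n)\<^sup>2 * S)"
    using tau n0 S by (simp add: lam \<tau>_def[symmetric] powr_powr flip: powr_numeral)
  define \<gamma> where "\<gamma> j = (if j \<in> G then \<nu> * p j powr (2 / (4 - t)) else 0)" for j
  have gam: "0 \<le> \<gamma> j \<and> \<gamma> j \<le> p j" if "j \<in> {1..N}" for j
  proof (cases "j \<in> G")
    case True
    have "\<nu> * p j powr (2 / (4 - t)) \<le> p j powr ((2 - t) / (4 - t)) * p j powr (2 / (4 - t))"
      using Gp[OF True] by (intro mult_right_mono) auto
    also have "\<dots> = p j powr ((2 - t) / (4 - t) + 2 / (4 - t))"
      by (simp add: powr_add)
    also have "(2 - t) / (4 - t) + 2 / (4 - t) = 1"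
      using t by (simp flip: add_divide_distrib)
    finally show ?thesis
      using True lam0 Gp[OF True] by (simp add: \<gamma>_def)
  qed (use p[OF that] in \<open>auto simp: \<gamma>_def\<close>)
  have "(\<Sum>j\<in>{1..N}. ((\<gamma> j)\<^sup>2 / p j)\<^sup>2) = (\<Sum>j\<in>G. \<nu> ^ 4 * p j powr r)"
  proof (rule sum.mono_neutral_cong_right)
    fix j assume j: "j \<in> G"
    have pj: "0 < p j"
      using Gp[OF j] by simp
    have r': "r = 2 / (4 - t) * 4 - 2"
      using t by (simp add: r field_simps)
    have "((\<gamma> j)\<^sup>2 / p j)\<^sup>2 = \<nu> ^ 4 * ((p j powr (2 / (4 - t))) ^ 4 / (p j)\<^sup>2)"
      using j by (simp add: \<gamma>_def power_divide power_mult_distrib)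
    also have "(p j powr (2 / (4 - t))) ^ 4 = p j powr (2 / (4 - t) * 4)"
      using pj by (simp add: powr_powr flip: powr_numeral)
    also have "\<dots> / (p j)\<^sup>2 = p j powr r"
      unfolding r' using pj by (simp add: powr_diff)
    finally show "((\<gamma> j)\<^sup>2 / p j)\<^sup>2 = \<nu> ^ 4 * p j powr r" .
  qed (use G in \<open>auto simp: \<gamma>_def\<close>)
  also have "\<dots> \<le> \<nu> ^ 4 * S"
    unfolding sum_distrib_left[symmetric] using upper lam0 by (intro mult_left_mono) auto
  also have "\<dots> = \<tau>\<^sup>2 / 256 / (real n)\<^sup>2"
    using S by (simp add: lam4)
  finally have "(real n)\<^sup>2 * (\<Sum>j\<in>{1..N}. ((\<gamma> j)\<^sup>2 / p j)\<^sup>2) \<le> (1 - \<eta>)\<^sup>2 / 256"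
    using n0 by (simp add: \<tau>_def field_simps)
  then have und: "undetectable \<eta> t n N p \<psi> ((\<Sum>j\<in>{1..N}. \<gamma> j powr t) powr (1 / t))"
    by (intro undetectable_symmetric_shift p gam eta) auto
  have "(\<Sum>j\<in>{1..N}. \<gamma> j powr t) = (\<Sum>j\<in>G. \<nu> powr t * p j powr r)"
    by (rule sum.mono_neutral_cong_right)
      (use G t in \<open>auto simp: \<gamma>_def powr_mult powr_powr r mult.commute\<close>)
  also have "\<dots> \<ge> \<nu> powr t * (S / 2)"
    unfolding sum_distrib_left[symmetric] using lower by (intro mult_left_mono) auto
  finally have "(\<nu> powr t * (S / 2)) powr (1 / t) \<le> (\<Sum>j\<in>{1..N}. \<gamma> j powr t) powr (1 / t)"
    using S t by (intro powr_mono2) auto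
  moreover have "\<tau> / 8 * sqrt (S powr (1 / r) / n) \<le> (\<nu> powr t * (S / 2)) powr (1 / t)"
  proof -
    have h: "1 / 2 \<le> (1 / 2 :: real) powr (1 / t)"
      using t powr_mono'[of "1 / t" 1 "1 / 2"] by simp
    \<comment> \<open>The fourth root is \<open>sqrt \<tau> / 4\<close>, and
      \<open>\<tau> \<le> 1\<close>.\<close>
    have tau': "\<tau> / 4 \<le> (\<tau>\<^sup>2 / 256) powr (1 / 4)"
    proof -
      have "\<tau> / 4 = ((\<tau> / 4) ^ 4) powr (1 / 4)"
        using tau by (simp add: powr_powr flip: powr_numeral)
      also have "(\<tau> / 4) ^ 4 \<le> \<tau>\<^sup>2 / 256"
        using tau power_decreasing[of 2 4 \<tau>] by (simp add: power_divide)
      then have "((\<tau> / 4) ^ 4) powr (1 / 4) \<le> (\<tau>\<^sup>2 / 256) powr (1 / 4)"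
        by (intro powr_mono2) auto
      finally show ?thesis .
    qed
    \<comment> \<open>From \<open>S powr (1 / t)\<close> the factor \<open>\<nu>\<close> takes away
      \<open>S powr (1 / 4)\<close>; what remains is the square root of
      \<open>S powr (1 / r)\<close>.\<close>
    have e: "1 / (2 * r) = 1 / t - 1 / 4"
      using t by (simp add: r field_simps)
    have "sqrt (S powr (1 / r) / n) = S powr (1 / t - 1 / 4) / sqrt n"
      unfolding e[symmetric] by (simp add: real_sqrt_divide powr_powr mult.commute flip: powr_half_sqrt)
    then have "\<tau> / 8 * sqrt (S powr (1 / r) / n) = \<tau> / 4 * (1 / 2 * (S powr (1 / t - 1 / 4) / sqrt n))"
      by simp
    also have "\<dots> \<le> (\<tau>\<^sup>2 / 256) powr (1 / 4) * ((1 / 2) powr (1 / t) * (S powr (1 / t - 1 / 4) / sqrt n))"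
      using tau by (intro mult_mono[OF tau'] mult_right_mono[OF h]) auto
    also have "\<dots> = \<nu> * (S / 2) powr (1 / t)"
    proof -
      have "((real n)\<^sup>2) powr (1 / 4) = sqrt n"
        using n0 by (simp add: powr_powr powr_half_sqrt flip: powr_numeral)
      then have "\<nu> = (\<tau>\<^sup>2 / 256) powr (1 / 4) / (sqrt n * S powr (1 / 4))"
        unfolding lam \<tau>_def[symmetric] powr_divide[of "\<tau>\<^sup>2 / 256"] powr_mult by simp
      moreover have "(S / 2) powr (1 / t) = (1 / 2) powr (1 / t) * S powr (1 / t)"
        using powr_mult[of "1 / 2" S "1 / t"] by simp
      ultimately show ?thesis
        unfolding powr_diff by simp
    qed
    also have "\<dots> = (\<nu> powr t * (S / 2)) powr (1 / t)"
      unfolding powr_mult using lam0 t by (simp add: powr_powr)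
    finally show ?thesis .
  qed
  ultimately show ?thesis
    unfolding \<tau>_def by (intro undetectable_mono[OF und]) linarith
qed

section \<open>Comparison of the head with the sparse rate\<close>

text \<open>For \<open>x\<close> up to \<open>m\<close> the nondecreasing power \<open>r - 1\<close>
  is replaced by its value at \<open>m\<close>; beyond \<open>m\<close> the same is done with the
  nonincreasing power \<open>r - 2\<close>.\<close>

lemma powr_le_linear_plus_square:
  fixes x m r :: real
  assumes "0 \<le> x" "0 < m" "1 \<le> r" "r \<le> 2"
  shows "x powr r \<le> x * m powr (r - 1) + x\<^sup>2 * m powr (r - 2)"
proof (cases "x = 0")
  case False
  then have x: "0 < x"
    using assms by simp
  have lin: "x powr r = x * x powr (r - 1)" and sq: "x powr r = x\<^sup>2 * x powr (r - 2)"
    using x by (simp_all add: powr_diff power2_eq_square)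
  show ?thesis
  proof (cases "x \<le> m")
    case True
    then have "x * x powr (r - 1) \<le> x * m powr (r - 1)"
      using x assms by (intro mult_left_mono powr_mono2) auto
    moreover have "0 \<le> x\<^sup>2 * m powr (r - 2)"
      by simp
    ultimately show ?thesis
      using lin by linarith
  next
    case False
    then have "x\<^sup>2 * x powr (r - 2) \<le> x\<^sup>2 * m powr (r - 2)"
      using assms by (intro mult_left_mono powr_mono2') auto
    moreover have "0 \<le> x * m powr (r - 1)"
      using x by simp
    ultimately show ?thesis
      using sq by linarith
  qed
qed simp

text \<open>At the scale \<open>m = 1 / (n^2 * s1)\<close> of the sparse prior the bounds on the
  first and second moments contribute equally, so for \<open>r \<ge> 1\<close> interpolation
  suffices. For \<open>r < 1\<close> many tiny entries could make the sum large, and a lower bound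
  \<open>c * m\<close> on the entries excludes them.\<close>

lemma sum_powr_le_tail:
  fixes p :: "'a \<Rightarrow> real" and r c n s1 :: real
  assumes p: "\<And>j. j \<in> H \<Longrightarrow> 0 \<le> p j" and fin: "finite H"
    and r: "0 < r" "r \<le> 2" and c: "0 < c" "c \<le> 1/2" and n: "0 < n" and s1: "0 < s1"
    and sum1: "(\<Sum>j\<in>H. p j) \<le> s1" and sum2: "(\<Sum>j\<in>H. (p j)\<^sup>2) \<le> 1 / n\<^sup>2"
    and low: "r < 1 \<Longrightarrow> \<forall>j\<in>H. c / (n\<^sup>2 * s1) \<le> p j"
  shows "(\<Sum>j\<in>H. p j powr r) \<le> 1 / c * (s1 * (1 / (n\<^sup>2 * s1)) powr (r - 1))"
proof -
  define m where "m = 1 / (n\<^sup>2 * s1)"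
  have m: "0 < m"
    using n s1 by (simp add: m_def)
  show ?thesis
  proof (cases "r < 1")
    case True
    have "(\<Sum>j\<in>H. p j powr r) \<le> (\<Sum>j\<in>H. p j * (1 / c * m powr (r - 1)))"
    proof (intro sum_mono)
      fix j assume j: "j \<in> H"
      have cm: "c * m \<le> p j"
        using low[OF True] j by (simp add: m_def)
      moreover have "0 < c * m"
        using c m by simp
      ultimately have pj: "0 < p j"
        by linarith
      have "p j powr r = p j * p j powr (r - 1)"
        using pj by (simp add: powr_diff)
      also have "\<dots> \<le> p j * (c * m) powr (r - 1)"
        using cm True c m pj by (intro mult_left_mono powr_mono2') auto
      also have "(c * m) powr (r - 1) = c powr (r - 1) * m powr (r - 1)"
        by (rule powr_mult)
      also have "\<dots> \<le> 1 / c * m powr (r - 1)"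
      proof (rule mult_right_mono)
        have "c powr (r - 1) \<le> c powr (- 1)"
          using c r by (intro powr_mono') auto
        also have "\<dots> = 1 / c"
          using c by (simp add: powr_minus_divide)
        finally show "c powr (r - 1) \<le> 1 / c" .
      qed simp
      finally show "p j powr r \<le> p j * (1 / c * m powr (r - 1))"
        using pj by simp
    qed
    also have "\<dots> = (\<Sum>j\<in>H. p j) * (1 / c * m powr (r - 1))"
      by (simp only: sum_distrib_right)
    also have "\<dots> \<le> s1 * (1 / c * m powr (r - 1))"
      using sum1 c by (intro mult_right_mono) auto
    finally show ?thesis
      by (simp add: m_def)
  next
    case False
    have "(\<Sum>j\<in>H. p j powr r) \<le> (\<Sum>j\<in>H. p j * m powr (r - 1) + (p j)\<^sup>2 * m powr (r - 2))"
      using p m r False by (intro sum_mono powr_le_linear_plus_square) auto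
    also have "\<dots> = (\<Sum>j\<in>H. p j) * m powr (r - 1) + (\<Sum>j\<in>H. (p j)\<^sup>2) * m powr (r - 2)"
      by (simp only: sum.distrib sum_distrib_right)
    also have "\<dots> \<le> s1 * m powr (r - 1) + (1 / n\<^sup>2) * m powr (r - 2)"
      using sum1 sum2 by (intro add_mono mult_right_mono) auto
    also have "m powr (r - 2) = m powr (r - 1) / m"
      using m powr_diff[of m "r - 1" 1] by simp
    also have "1 / n\<^sup>2 * (m powr (r - 1) / m) = s1 * m powr (r - 1)"
      using n s1 by (simp add: m_def)
    also have "s1 * m powr (r - 1) + s1 * m powr (r - 1) = 2 * (s1 * m powr (r - 1))"
      by simp
    also have "\<dots> \<le> 1 / c * (s1 * m powr (r - 1))"
      using c s1 by (intro mult_right_mono) (auto simp: field_simps)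
    finally show ?thesis
      by (simp add: m_def)
  qed
qed

section \<open>The cut-off index\<close>

lemma idx_I_le: "0 < cI \<Longrightarrow> idx_I cI n N p \<le> N"
  and idx_I_tail: "0 < cI \<Longrightarrow> (\<Sum>i\<in>{idx_I cI n N p<..N}. (p i)\<^sup>2) \<le> cI / (real n)\<^sup>2"
proof -
  assume "0 < cI"
  then have "N \<le> N \<and> (\<Sum>i\<in>{N<..N}. (p i)\<^sup>2) \<le> cI / (real n)\<^sup>2"
    by simp
  from LeastI[of "\<lambda>J. J \<le> N \<and> (\<Sum>i\<in>{J<..N}. (p i)\<^sup>2) \<le> cI / (real n)\<^sup>2", OF this]
  show "idx_I cI n N p \<le> N" "(\<Sum>i\<in>{idx_I cI n N p<..N}. (p i)\<^sup>2) \<le> cI / (real n)\<^sup>2"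
    unfolding idx_I_def by auto
qed

lemma idx_I_minimal:
  assumes "0 < cI" "1 \<le> idx_I cI n N p"
  shows "cI / (real n)\<^sup>2 < (\<Sum>i\<in>{idx_I cI n N p..N}. (p i)\<^sup>2)"
proof -
  let ?I = "idx_I cI n N p"
  have "\<not> (?I - 1 \<le> N \<and> (\<Sum>i\<in>{?I - 1<..N}. (p i)\<^sup>2) \<le> cI / (real n)\<^sup>2)"
    by (rule not_less_Least) (use assms in \<open>simp add: idx_I_def\<close>)
  moreover have "?I - 1 \<le> N"
    using idx_I_le[OF assms(1), of n N p] by linarith
  \<comment> \<open>As \<open>?I\<close> is at least 1, the subtraction is not truncated: the
    failure at \<open>?I - 1\<close> concerns the tail that includes \<open>?I\<close>.\<close>
  moreover have "{?I - 1<..N} = {?I..N}"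
    using assms(2) by auto
  ultimately show ?thesis
    by simp
qed

lemma lnorm_trunc_le:
  assumes "u \<le> N" "\<And>j. j \<in> {1..N} \<Longrightarrow> 0 \<le> p j"
  shows "lnorm r N (trunc_le u p) = (\<Sum>j\<in>{1..u}. p j powr r) powr (1 / r)"
proof -
  have "(\<Sum>j\<in>{1..N}. \<bar>trunc_le u p j\<bar> powr r) = (\<Sum>j\<in>{1..u}. p j powr r)"
    by (rule sum.mono_neutral_cong_right) (use assms in \<open>auto simp: trunc_le_def\<close>)
  then show ?thesis
    by (simp add: lnorm_def)
qed

lemma lnorm_one_trunc_gt:
  assumes "\<And>j. j \<in> {1..N} \<Longrightarrow> 0 \<le> p j"
  shows "lnorm 1 N (trunc_gt u p) = (\<Sum>j\<in>{u<..N}. p j)"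
proof -
  have "(\<Sum>j\<in>{1..N}. \<bar>trunc_gt u p j\<bar>) = (\<Sum>j\<in>{u<..N}. p j)"
    by (rule sum.mono_neutral_cong_right) (use assms in \<open>auto simp: trunc_gt_def\<close>)
  moreover have "0 \<le> (\<Sum>j\<in>{u<..N}. p j)"
    using assms by (intro sum_nonneg) auto
  ultimately show ?thesis
    by (simp add: lnorm_def)
qed

text \<open>Either the coordinates \<open>G\<close>, where the symmetric shift fits below
  \<open>p\<close>, carry half of \<open>S\<close>, or the rest \<open>H\<close> of the head does.
  In the second case \<open>H\<close> and the tail beyond \<open>I\<close> together support a sparse
  prior whose rate dominates up to the factor \<open>2 / cI\<close>.\<close>

lemma undetectable_main_term:
  assumes p: "\<And>j. j \<in> {1..N} \<Longrightarrow> p j \<in> {0..1/2}"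
    and mono: "\<And>i j. i \<in> {1..N} \<Longrightarrow> j \<in> {1..N} \<Longrightarrow> i \<le> j \<Longrightarrow> p j \<le> p i"
    and N: "1 \<le> N" and n: "2 \<le> n" and t: "1 \<le> t" "t \<le> 2" and eta: "0 \<le> \<eta>" "\<eta> < 1"
    and g: "g = (1 - \<eta>) / 32"
    and cI: "0 < cI" "cI \<le> (1 - \<eta>) / 256"
    and I: "I = idx_I cI n N p" and r: "r = 2 * t / (4 - t)"
    and S: "S = (\<Sum>j\<in>{1..I}. p j powr r)"
  shows "undetectable \<eta> t n N p \<psi> (g * cI / 64 * sqrt (S powr (1 / r) / n))"
proof -
  define \<tau> where "\<tau> = 1 - \<eta>"
  have tau: "0 < \<tau>" "\<tau> \<le> 1"
    using eta by (auto simp: \<tau>_def)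
  have g01: "0 < g" "g \<le> 1/32" and gtau: "g = \<tau> / 32"
    using g eta by (auto simp: \<tau>_def)
  have cI1: "cI \<le> 1 / 256"
    using cI tau by (simp add: \<tau>_def[symmetric])
  have n0: "0 < real n"
    using n by simp
  have r0: "0 < r" "r \<le> 2"
    using t by (auto simp: r field_simps)
  have IN: "I \<le> N"
    unfolding I by (rule idx_I_le[OF cI(1)])
  have pnn: "0 \<le> p j" if "j \<in> {1..N}" for j
    using p[OF that] by simp
  have S0: "0 \<le> S"
    unfolding S by (intro sum_nonneg) auto
  show ?thesis
  proof (cases "S = 0")
    case True
    \<comment> \<open>With \<open>S = 0\<close> the target distance is 0, so any undetectable
      alternative serves.\<close>
    have "undetectable \<eta> t n N p \<psi> (g / n)"
      using g g01 eta t by (intro undetectable_single_shift p N n) auto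
    then show ?thesis
      using True g01 by (auto intro: undetectable_mono)
  next
    case False
    then have Spos: "0 < S"
      using S0 by simp
    define \<nu> where "\<nu> = ((1 - \<eta>)\<^sup>2 / 256 / ((real n)\<^sup>2 * S)) powr (1 / 4)"
    have lam0: "0 < \<nu>"
      using eta n0 Spos by (simp add: \<nu>_def)
    have lam4: "\<nu> ^ 4 = \<tau>\<^sup>2 / 256 / ((real n)\<^sup>2 * S)"
      using tau n0 Spos by (simp add: \<nu>_def \<tau>_def[symmetric] powr_powr flip: powr_numeral)
    define G where "G = {j\<in>{1..I}. \<nu> \<le> p j powr ((2 - t) / (4 - t))}"
    define H where "H = {1..I} - G"
    have G: "G \<subseteq> {1..I}" "G \<subseteq> {1..N}" "finite G"
      using IN by (auto simp: G_def)
    have split: "S = (\<Sum>j\<in>H. p j powr r) + (\<Sum>j\<in>G. p j powr r)"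
      unfolding S H_def using G by (intro sum.subset_diff) auto
    show ?thesis
    proof (cases "S / 2 \<le> (\<Sum>j\<in>G. p j powr r)")
      case True
      have "undetectable \<eta> t n N p \<psi> ((1 - \<eta>) / 8 * sqrt (S powr (1 / r) / n))"
      proof (rule undetectable_head[OF p G(2) _ t eta r Spos \<nu>_def _ _ True])
        fix j assume j: "j \<in> G"
        then have "p j \<noteq> 0"
          using lam0 by (auto simp: G_def)
        then show "0 < p j \<and> \<nu> \<le> p j powr ((2 - t) / (4 - t))"
          using j pnn[of j] IN by (auto simp: G_def)
      next
        show "(\<Sum>j\<in>G. p j powr r) \<le> S"
          unfolding split by (simp add: sum_nonneg)
      qed (use n in auto)
      moreover have "g * cI / 64 \<le> (1 - \<eta>) / 8"
        using mult_mono[of g 1 cI 1] g01 cI1 cI tau mult_left_mono[of cI 1 \<tau>]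
        by (simp add: \<tau>_def[symmetric] gtau)
      then have "g * cI / 64 * sqrt (S powr (1 / r) / n) \<le> (1 - \<eta>) / 8 * sqrt (S powr (1 / r) / n)"
        by (intro mult_right_mono) auto
      ultimately show ?thesis
        by (rule undetectable_mono)
    next
      case False
      then have HS: "S / 2 \<le> (\<Sum>j\<in>H. p j powr r)"
        using split by linarith
      define T where "T = {1..N} - G"
      define s1 where "s1 = (\<Sum>j\<in>T. p j)"
      have T: "T \<subseteq> {1..N}" "finite T" "H \<subseteq> T" "finite H"
        using IN by (auto simp: T_def H_def)
      have T_eq: "T = H \<union> {I<..N}" "H \<inter> {I<..N} = {}"
        using IN G by (auto simp: T_def H_def)
      \<comment> \<open>On \<open>H\<close> one has
        \<open>p j powr ((2 - t) / (4 - t)) < \<nu>\<close>. The fourth power of the left side times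
        \<open>p j powr r\<close> is \<open>(p j)^2\<close>, so the squares are controlled by
        \<open>\<nu>^4 * S\<close>.\<close>
      have "(\<Sum>j\<in>H. (p j)\<^sup>2) \<le> (\<Sum>j\<in>H. \<nu> ^ 4 * p j powr r)"
      proof (intro sum_mono)
        fix j assume j: "j \<in> H"
        show "(p j)\<^sup>2 \<le> \<nu> ^ 4 * p j powr r"
        proof (cases "p j = 0")
          case False
          then have pj: "0 < p j"
            using pnn[of j] j T by force
          have e: "2 = (2 - t) / (4 - t) * 4 + r"
            using t by (simp add: r divide_simps)
          have "(p j)\<^sup>2 = p j powr 2"
            using pj by simp
          also have "\<dots> = (p j powr ((2 - t) / (4 - t))) ^ 4 * p j powr r"
            using pj by (subst e) (simp add: powr_add powr_powr flip: powr_numeral)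
          also have "\<dots> \<le> \<nu> ^ 4 * p j powr r"
            using j by (intro mult_right_mono power_mono) (auto simp: H_def G_def)
          finally show ?thesis .
        qed simp
      qed
      also have "\<dots> \<le> \<nu> ^ 4 * S"
        unfolding sum_distrib_left[symmetric] split
        by (intro mult_left_mono) (auto simp: sum_nonneg)
      also have "\<dots> = \<tau>\<^sup>2 / 256 / (real n)\<^sup>2"
        using Spos by (simp add: lam4)
      also have "\<dots> \<le> \<tau> / 256 / (real n)\<^sup>2"
        using tau by (intro divide_right_mono) (auto simp: power2_eq_square mult_left_le)
      finally have H2: "(\<Sum>j\<in>H. (p j)\<^sup>2) \<le> \<tau> / 256 / (real n)\<^sup>2" .
      have "(\<Sum>j\<in>{I<..N}. (p j)\<^sup>2) \<le> cI / (real n)\<^sup>2"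
        unfolding I by (rule idx_I_tail[OF cI(1)])
      also have "\<dots> \<le> \<tau> / 256 / (real n)\<^sup>2"
        using cI by (intro divide_right_mono) (auto simp: \<tau>_def)
      \<comment> \<open>Head and tail contribute at most \<open>\<tau> / 256\<close> each, the
        former by the choice of \<open>\<nu>\<close>, the latter by the bound on \<open>cI\<close>;
        the sum is \<open>g / 4 = \<tau> / 128\<close>.\<close>
      finally have T2: "(\<Sum>j\<in>T. (p j)\<^sup>2) \<le> g / 4 / (real n)\<^sup>2"
        unfolding T_eq(1) using H2 T T_eq(2) by (subst sum.union_disjoint) (auto simp: gtau)
      have Hpos: "\<exists>j\<in>H. 0 < p j"
      proof (rule ccontr)
        assume "\<not> ?thesis"
        then have "p j = 0" if "j \<in> H" for j
          using that pnn[of j] T by force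
        then have "(\<Sum>j\<in>H. p j powr r) = 0"
          by simp
        then show False
          using HS Spos by simp
      qed
      have pT: "0 \<le> p j" if "j \<in> T" for j
        using pnn that T by blast
      have s1pos: "0 < s1"
      proof -
        obtain j where j: "j \<in> H" "0 < p j"
          using Hpos by blast
        then have "p j \<le> s1"
          unfolding s1_def using pT T by (intro member_le_sum) auto
        then show ?thesis
          using j by simp
      qed
      \<comment> \<open>Monotonicity reduces the claim to \<open>p I\<close> and also puts
        \<open>I\<close> into \<open>H\<close>. By minimality of \<open>I\<close>,
        \<open>cI / n^2\<close> is below the sum of squares from \<open>I\<close> on, which is at
        most \<open>p I * s1\<close> since all these indices lie in \<open>T\<close>.\<close>
      have low: "cI / ((real n)\<^sup>2 * s1) \<le> p j" if j: "j \<in> H" for j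
      proof -
        have jI: "1 \<le> j" "j \<le> I"
          using j by (auto simp: H_def)
        then have "p I \<le> p j"
          using IN by (intro mono) auto
        moreover have "I \<in> H"
        proof -
          have "p I powr ((2 - t) / (4 - t)) \<le> p j powr ((2 - t) / (4 - t))"
            using \<open>p I \<le> p j\<close> pnn[of I] jI IN t by (intro powr_mono2) auto
          also have "\<dots> < \<nu>"
            using j by (auto simp: H_def G_def)
          finally show ?thesis
            using jI by (auto simp: H_def G_def)
        qed
        moreover have "cI / (real n)\<^sup>2 \<le> p I * s1"
        proof -
          have "cI / (real n)\<^sup>2 \<le> (\<Sum>i\<in>{I..N}. (p i)\<^sup>2)"
            using idx_I_minimal[OF cI(1), of n N p] jI unfolding I by simp
          also have "\<dots> \<le> (\<Sum>i\<in>{I..N}. p I * p i)"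
          proof (intro sum_mono)
            fix i assume i: "i \<in> {I..N}"
            then have "p i \<le> p I" "0 \<le> p i"
              using jI mono[of I i] pnn[of i] by auto
            then show "(p i)\<^sup>2 \<le> p I * p i"
              unfolding power2_eq_square by (intro mult_right_mono)
          qed
          also have "\<dots> \<le> (\<Sum>i\<in>T. p I * p i)"
          proof (rule sum_mono2)
            show "{I..N} \<subseteq> T"
              using \<open>I \<in> H\<close> T_eq(1) by (auto simp: le_less)
            show "0 \<le> p I * p i" if "i \<in> T - {I..N}" for i
              using that pT[of i] pnn[of I] jI IN by simp
          qed (rule T(2))
          finally show ?thesis
            by (simp add: s1_def sum_distrib_left)
        qed
        then have "cI / ((real n)\<^sup>2 * s1) \<le> p I"
          using s1pos n0 by (simp add: field_simps)
        ultimately show ?thesis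
          by linarith
      qed
      have "(\<Sum>j\<in>H. p j powr r) \<le> 1 / cI * (s1 * (1 / ((real n)\<^sup>2 * s1)) powr (r - 1))"
      proof (rule sum_powr_le_tail)
        show "(\<Sum>j\<in>H. p j) \<le> s1"
          unfolding s1_def using T pT by (intro sum_mono2) auto
        have "\<tau> / 256 / (real n)\<^sup>2 \<le> 1 / (real n)\<^sup>2"
          using tau by (intro divide_right_mono) auto
        then show "(\<Sum>j\<in>H. (p j)\<^sup>2) \<le> 1 / (real n)\<^sup>2"
          using H2 by linarith
      qed (use low T pT r0 cI cI1 n0 s1pos in auto)
      then have S_le: "S \<le> 2 / cI * (s1 * (1 / ((real n)\<^sup>2 * s1)) powr (r - 1))"
        using HS by simp
      \<comment> \<open>These identities turn the bound on \<open>S\<close> into the two exponents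
        of the sparse rate.\<close>
      have e1: "1 / (2 * r) - (r - 1) / (2 * r) = (2 - t) / t"
        and e2: "(r - 1) / r + 1 / 2 = (2 * t - 2) / t"
        using t by (auto simp: r field_simps)
      have "sqrt (S powr (1 / r) / n) = S powr (1 / (2 * r)) / n powr (1 / 2)"
        using n0 by (simp add: real_sqrt_divide powr_powr mult.commute flip: powr_half_sqrt)
      also have "\<dots> \<le> (2 / cI * (s1 * (1 / ((real n)\<^sup>2 * s1)) powr (r - 1))) powr (1 / (2 * r)) / n powr (1 / 2)"
        using S_le S0 r0 by (intro divide_right_mono powr_mono2) auto
      also have "\<dots> = (2 / cI) powr (1 / (2 * r)) *
          (s1 powr (1 / (2 * r) - (r - 1) / (2 * r)) / n powr ((r - 1) / r + 1 / 2))"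
      proof -
        define k where "k = (r - 1) / (2 * r)"
        have k: "(r - 1) * (1 / (2 * r)) = k" "(r - 1) / r = 2 * k"
          using r0 by (auto simp: k_def field_simps)
        have "(1 / ((real n)\<^sup>2 * s1)) powr k = 1 / (n powr (2 * k) * s1 powr k)"
          using n0 by (simp add: powr_divide powr_mult powr_powr flip: powr_numeral)
        then show ?thesis
          unfolding powr_mult powr_powr k(1) k_def[symmetric] k(2)
          unfolding powr_diff powr_add by simp
      qed
      also have "\<dots> = (2 / cI) powr (1 / (2 * r)) * (s1 powr ((2 - t) / t) / n powr ((2 * t - 2) / t))"
        unfolding e1 e2 ..
      also have "\<dots> \<le> 2 / cI * (s1 powr ((2 - t) / t) / n powr ((2 * t - 2) / t))"
      proof (rule mult_right_mono)
        have "1 / (2 * r) \<le> 1"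
          using t by (simp add: r field_simps)
        then have "(2 / cI) powr (1 / (2 * r)) \<le> (2 / cI) powr 1"
          using cI cI1 by (intro powr_mono) (auto simp: field_simps)
        then show "(2 / cI) powr (1 / (2 * r)) \<le> 2 / cI"
          using cI by simp
      qed auto
      \<comment> \<open>The factor \<open>cI\<close> in the constant absorbs \<open>2 / cI\<close>
        and leaves the \<open>g / 32\<close> of \<open>undetectable_tail\<close>.\<close>
      finally have "g * cI / 64 * sqrt (S powr (1 / r) / n)
          \<le> g * cI / 64 * (2 / cI * (s1 powr ((2 - t) / t) / n powr ((2 * t - 2) / t)))"
        using g01 cI by (intro mult_left_mono) auto
      also have "\<dots> = g / 32 * (rpow s1 ((2 - t) / t) / n powr ((2 * t - 2) / t))"
        using cI s1pos by (simp add: rpow_def)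
      finally show ?thesis
        using undetectable_tail[OF p T(1) N n t eta g T2] unfolding s1_def
        by (blast intro: undetectable_mono)
    qed
  qed
qed

section \<open>Assembly of the three rates\<close>

theorem theorem2:
  fixes \<eta> :: real
  assumes "0 < \<eta>" and "\<eta> < 1"
  shows "\<exists>c0>0. \<forall>cI. 0 < cI \<and> cI \<le> c0 \<longrightarrow>
    (\<exists>c'>0. \<forall>(t::real) (N::nat) (n::nat) (p::nat \<Rightarrow> real)
        (\<psi>::(nat \<Rightarrow> nat \<Rightarrow> bool) \<Rightarrow> bool).
      1 \<le> t \<and> t \<le> 2 \<and> N \<ge> 2 \<and> n \<ge> 2 \<and> even n \<and>
      (\<forall>j\<in>{1..N}. 0 \<le> p j \<and> p j \<le> 1/2) \<and>
      (\<forall>i\<in>{1..N}. \<forall>j\<in>{1..N}. i \<le> j \<longrightarrow> p j \<le> p i)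
      \<longrightarrow>
      (let r = 2 * t / (4 - t); I = idx_I cI n N p in
       \<exists>q::nat \<Rightarrow> real. (\<forall>j\<in>{1..N}. 0 \<le> q j \<and> q j \<le> 1) \<and>
         lnorm t N (\<lambda>j. q j - p j) \<ge>
           c' * (sqrt (lnorm r N (trunc_le I p) / real n)
                 + rpow (lnorm 1 N (trunc_gt I p)) ((2 - t) / t)
                     / real n powr ((2 * t - 2) / t)
                 + 1 / real n) \<and>
         binom_prob n N p (\<lambda>x. \<psi> x) + binom_prob n N q (\<lambda>x. \<not> \<psi> x) \<ge> \<eta>))"
proof (rule exI[of _ "(1 - \<eta>) / 256"], intro conjI allI impI)
  show "0 < (1 - \<eta>) / 256"
    using assms by simp
  fix cI assume cI: "0 < cI \<and> cI \<le> (1 - \<eta>) / 256"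
  define g where "g = (1 - \<eta>) / 32"
  have g01: "0 < g" "g \<le> 1 / 32"
    using assms by (auto simp: g_def)
  show "\<exists>c'>0. \<forall>(t::real) (N::nat) (n::nat) (p::nat \<Rightarrow> real)
        (\<psi>::(nat \<Rightarrow> nat \<Rightarrow> bool) \<Rightarrow> bool).
      1 \<le> t \<and> t \<le> 2 \<and> N \<ge> 2 \<and> n \<ge> 2 \<and> even n \<and>
      (\<forall>j\<in>{1..N}. 0 \<le> p j \<and> p j \<le> 1/2) \<and>
      (\<forall>i\<in>{1..N}. \<forall>j\<in>{1..N}. i \<le> j \<longrightarrow> p j \<le> p i)
      \<longrightarrow>
      (let r = 2 * t / (4 - t); I = idx_I cI n N p in
       \<exists>q::nat \<Rightarrow> real. (\<forall>j\<in>{1..N}. 0 \<le> q j \<and> q j \<le> 1) \<and>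
         lnorm t N (\<lambda>j. q j - p j) \<ge>
           c' * (sqrt (lnorm r N (trunc_le I p) / real n)
                 + rpow (lnorm 1 N (trunc_gt I p)) ((2 - t) / t)
                     / real n powr ((2 * t - 2) / t)
                 + 1 / real n) \<and>
         binom_prob n N p (\<lambda>x. \<psi> x) + binom_prob n N q (\<lambda>x. \<not> \<psi> x) \<ge> \<eta>)"
  \<comment> \<open>Each rate is reached with the factor \<open>g * cI / 64\<close>; the further 3
    pays for passing from the largest of three terms to their sum.\<close>
  proof (rule exI[of _ "g * cI / 192"], intro conjI allI impI, goal_cases)
    case 1
    show ?case
      using g01 cI by simp
  next
    case (2 t N n p \<psi>)
    then have t: "1 \<le> t" "t \<le> 2" and N: "1 \<le> N" and n: "2 \<le> n"
      and p: "\<And>j. j \<in> {1..N} \<Longrightarrow> p j \<in> {0..1/2}"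
      and mono: "\<And>i j. i \<in> {1..N} \<Longrightarrow> j \<in> {1..N} \<Longrightarrow> i \<le> j \<Longrightarrow> p j \<le> p i"
      by auto
    have eta: "0 \<le> \<eta>" "\<eta> < 1" and cI': "0 < cI" "cI \<le> (1 - \<eta>) / 256"
      using assms cI by auto
    have cI1: "cI \<le> 1"
      using order_trans[OF cI'(2), of 1] eta by simp
    define I where "I = idx_I cI n N p"
    define r where "r = 2 * t / (4 - t)"
    have pnn: "0 \<le> p j" if "j \<in> {1..N}" for j
      using p[OF that] by simp
    define A where "A = sqrt (lnorm r N (trunc_le I p) / real n)"
    define B where "B = rpow (lnorm 1 N (trunc_gt I p)) ((2 - t) / t) / real n powr ((2 * t - 2) / t)"
    define C where "C = 1 / real n"
    have nn: "0 \<le> B" "0 \<le> C"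
      by (auto simp: B_def C_def rpow_def)
    have coeff: "g * cI / 64 \<le> g / 32" "g * cI / 64 \<le> g"
      using mult_left_mono[OF cI1, of g] g01 by auto
    have IN: "I \<le> N"
      unfolding I_def by (rule idx_I_le[OF cI'(1)])
    have undA: "undetectable \<eta> t n N p \<psi> (g * cI / 64 * A)"
    proof -
      have "lnorm r N (trunc_le I p) = (\<Sum>j\<in>{1..I}. p j powr r) powr (1 / r)"
        by (rule lnorm_trunc_le[OF IN]) (rule pnn)
      then show ?thesis
        unfolding A_def
        using undetectable_main_term[OF p mono N n t eta g_def cI' I_def r_def refl] by simp
    qed
    have tail_norm: "lnorm 1 N (trunc_gt I p) = (\<Sum>j\<in>{I<..N}. p j)"
      by (rule lnorm_one_trunc_gt) (rule pnn)
    have undB: "undetectable \<eta> t n N p \<psi> (g * cI / 64 * B)"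
    proof (rule undetectable_mono)
      have "(\<Sum>j\<in>{I<..N}. (p j)\<^sup>2) \<le> cI / (real n)\<^sup>2"
        unfolding I_def by (rule idx_I_tail[OF cI'(1)])
      also have "\<dots> \<le> g / 4 / (real n)\<^sup>2"
        using cI' eta by (intro divide_right_mono) (auto simp: g_def)
      finally show "undetectable \<eta> t n N p \<psi> (g / 32 * B)"
        unfolding B_def tail_norm
        by (intro undetectable_tail[OF p _ N n t eta g_def]) auto
      show "g * cI / 64 * B \<le> g / 32 * B"
        using coeff nn by (intro mult_right_mono)
    qed
    have undC: "undetectable \<eta> t n N p \<psi> (g * cI / 64 * C)"
    proof (rule undetectable_mono)
      show "undetectable \<eta> t n N p \<psi> (g * C)"
        using undetectable_single_shift[OF p N n, where t = t and g = g and \<eta> = \<eta>] g01 t eta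
        by (simp add: C_def g_def)
      show "g * cI / 64 * C \<le> g * C"
        using coeff nn by (intro mult_right_mono)
    qed
    \<comment> \<open>The three alternatives are not combined: the one for the largest term serves
      for the sum.\<close>
    have und: "undetectable \<eta> t n N p \<psi> (g * cI / 64 * max A (max B C))"
      using undA undB undC by (auto simp: max_def)
    have "g * cI / 192 * (A + B + C) = g * cI / 64 * ((A + B + C) / 3)"
      by simp
    also have "\<dots> \<le> g * cI / 64 * max A (max B C)"
      using g01 cI' by (intro mult_left_mono) auto
    finally have "undetectable \<eta> t n N p \<psi> (g * cI / 192 * (A + B + C))"
      by (rule undetectable_mono[OF und])
    then show ?case
      unfolding undetectable_def A_def B_def C_def I_def r_def Let_def .
  qed
qed

end
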